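(* Let $\alpha\in\mathbb{R}$ and let $Q_\alpha$ be the chaotic operator on $\mathbb{T}=\mathbb{R}/2\pi\mathbb{Z}$ with coefficients $\alpha_n=\alpha/\sqrt n$ defined in the context. Let $\sigma$ be a Borel probability measure on $\mathbb{T}$. If $\dim^*\sigma<\frac{\alpha^2}{4}$, then $Q_\alpha\sigma=0$ almost surely. In particular, if $|\alpha|>2$, then $Q_\alpha$ is completely degenerate: $Q_\alpha\sigma=0$ almost surely for every Borel probability measure $\sigma$ on $\mathbb{T}$.
   Context: $\{\omega_n\}_{n\ge1}$ are i.i.d. uniformly distributed on $\mathbb{T}$; $I_0(x)=\int_0^{2\pi}e^{x\cos u}\frac{du}{2\pi}$. Put $$Q_{N}(t)=\prod_{n=1}^N\frac{\exp\left(\frac{\alpha}{\sqrt n}\cos(nt+\omega_n)\right)}{I_0(\alpha/\sqrt n)}.$$ For every finite positive Borel measure $\sigma$ on $\mathbb{T}$, almost surely $Q_N\,d\sigma$ converges weakly to a random measure, denoted $Q_\alpha\sigma$. The upper Hausdorff dimension of a probability measure $\sigma$ is $\dim^*\sigma=\inf\{\dim E:\sigma(E)=1\}$, $E$ Borel and $\dim E$ its Hausdorff dimension. *)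

theory Defs
  imports "HOL-Probability.Probability"
begin

definition torus_rel :: "real \<Rightarrow> real \<Rightarrow> bool" where
  "torus_rel x y \<longleftrightarrow> (\<exists>k::int. x - y = 2 * pi * of_int k)"

lemma equivp_torus_rel: "equivp torus_rel"
proof (rule equivpI)
  show "reflp torus_rel"
    by (auto simp: reflp_def torus_rel_def intro: exI[of _ 0])
  show "symp torus_rel"
    unfolding symp_def torus_rel_def
  proof safe
    fix x y :: real and k :: int
    assume "x - y = 2 * pi * of_int k"
    then show "\<exists>k'::int. y - x = 2 * pi * of_int k'"
      by (intro exI[of _ "-k"]) simp
  qed
  show "transp torus_rel"
    unfolding transp_def torus_rel_def
  proof safe
    fix x y z :: real and k l :: int
    assume "x - y = 2 * pi * of_int k" "y - z = 2 * pi * of_int l"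
    then show "\<exists>m::int. x - z = 2 * pi * of_int m"
      by (intro exI[of _ "k + l"]) (simp add: algebra_simps)
  qed
qed

text \<open>The circle \<open>\<real> / 2\<pi>\<int>\<close>, as a group with its quotient (arc length) metric.\<close>

quotient_type torus = real / torus_rel
  by (rule equivp_torus_rel)

lift_definition torus_proj :: "real \<Rightarrow> torus" is "\<lambda>x. x" .

lift_definition torus_cos :: "torus \<Rightarrow> real" is cos
proof -
  fix x y assume "torus_rel x y"
  then obtain k :: int where "x = y + 2 * pi * of_int k"
    by (auto simp: torus_rel_def algebra_simps)
  then show "cos x = cos y"
    by (simp add: cos_add)
qed

lift_definition torus_multiple :: "nat \<Rightarrow> torus \<Rightarrow> torus" is "\<lambda>n t. real n * t"
proof -
  fix n :: nat and x y assume "torus_rel x y"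
  then obtain k :: int where "x - y = 2 * pi * of_int k"
    by (auto simp: torus_rel_def)
  then have "real n * x - real n * y = 2 * pi * of_int (int n * k)"
    by (simp flip: right_diff_distrib)
  then show "torus_rel (real n * x) (real n * y)"
    unfolding torus_rel_def by blast
qed

instantiation torus :: ab_group_add
begin

lift_definition zero_torus :: torus is 0 .

lift_definition plus_torus :: "torus \<Rightarrow> torus \<Rightarrow> torus" is "(+)"
proof -
  fix x y x' y' assume "torus_rel x y" "torus_rel x' y'"
  then obtain k l :: int where "x - y = 2 * pi * of_int k" "x' - y' = 2 * pi * of_int l"
    by (auto simp: torus_rel_def)
  then have "(x + x') - (y + y') = 2 * pi * of_int (k + l)"
    by (simp add: algebra_simps)
  then show "torus_rel (x + x') (y + y')"
    unfolding torus_rel_def by blast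
qed

lift_definition uminus_torus :: "torus \<Rightarrow> torus" is uminus
proof -
  fix x y assume "torus_rel x y"
  then obtain k :: int where "x - y = 2 * pi * of_int k"
    by (auto simp: torus_rel_def)
  then have "(- x) - (- y) = 2 * pi * of_int (- k)"
    by simp
  then show "torus_rel (- x) (- y)"
    unfolding torus_rel_def by blast
qed

definition minus_torus :: "torus \<Rightarrow> torus \<Rightarrow> torus" where
  "minus_torus s t = s + (- t)"

lemma torus_rel_refl: "torus_rel x x"
  using equivp_torus_rel by (rule equivp_reflp)

instance
proof
  fix a b c :: torus
  show "a + b + c = a + (b + c)" by transfer (simp add: torus_rel_refl add.assoc)
  show "a + b = b + a" by transfer (simp add: torus_rel_refl add.commute)
  show "0 + a = a" by transfer (simp add: torus_rel_refl)
  show "- a + a = 0" by transfer (simp add: torus_rel_refl)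
  show "a - b = a + - b" by (rule minus_torus_def)
qed

end

lemma torus_dist_shift:
  "(INF k::int. \<bar>x + 2 * pi * of_int m + 2 * pi * of_int k\<bar>) = (INF k::int. \<bar>x + 2 * pi * of_int k\<bar>)"
proof -
  let ?f = "\<lambda>k::int. \<bar>x + 2 * pi * of_int k\<bar>"
  have "(\<lambda>k::int. \<bar>x + 2 * pi * of_int m + 2 * pi * of_int k\<bar>) = ?f \<circ> (+) m"
    by (simp add: fun_eq_iff algebra_simps)
  then have "range (\<lambda>k::int. \<bar>x + 2 * pi * of_int m + 2 * pi * of_int k\<bar>) = ?f ` range ((+) m)"
    by (metis image_comp)
  also have "range ((+) m) = UNIV"
    by (rule surj_plus)
  finally show ?thesis by simp
qed

instantiation torus :: metric_space
begin

lift_definition dist_torus :: "torus \<Rightarrow> torus \<Rightarrow> real" is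
  "\<lambda>x y. INF k::int. \<bar>x - y + 2 * pi * of_int k\<bar>"
proof -
  fix x y x' y' assume "torus_rel x y" "torus_rel x' y'"
  then obtain k l :: int where "x - y = 2 * pi * of_int k" "x' - y' = 2 * pi * of_int l"
    by (auto simp: torus_rel_def)
  then have eq: "x - x' = y - y' + 2 * pi * of_int (k - l)"
    by (simp add: algebra_simps)
  show "(INF k::int. \<bar>x - x' + 2 * pi * of_int k\<bar>) = (INF k::int. \<bar>y - y' + 2 * pi * of_int k\<bar>)"
    unfolding eq by (rule torus_dist_shift)
qed

definition uniformity_torus :: "(torus \<times> torus) filter" where
  "uniformity_torus = (INF e\<in>{0 <..}. principal {(x, y). dist x y < e})"

definition open_torus :: "torus set \<Rightarrow> bool" where
  "open_torus U \<longleftrightarrow> (\<forall>x\<in>U. \<forall>\<^sub>F (x', y) in uniformity. x' = x \<longrightarrow> y \<in> U)"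

lemma torus_dist_bdd: "bdd_below (range (\<lambda>k::int. \<bar>x + 2 * pi * of_int k\<bar>))"
  by (rule bdd_belowI[of _ 0]) auto

lemma torus_dist_eq0:
  assumes "(INF k::int. \<bar>x - y + 2 * pi * of_int k\<bar>) = 0"
  shows "torus_rel x y"
proof -
  have ex: "\<exists>k::int. \<bar>x - y + 2 * pi * of_int k\<bar> < e" if "e > 0" for e
    using cINF_less_iff[OF UNIV_not_empty torus_dist_bdd[of "x - y"], of e] assms that by simp
  obtain k :: int where k: "\<bar>x - y + 2 * pi * of_int k\<bar> < pi"
    using ex[of pi] by auto
  define u where "u = x - y + 2 * pi * of_int k"
  have "u = 0"
  proof (rule ccontr)
    assume "u \<noteq> 0"
    then obtain l :: int where l: "\<bar>x - y + 2 * pi * of_int l\<bar> < \<bar>u\<bar>"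
      using ex[of "\<bar>u\<bar>"] by auto
    have "(x - y + 2 * pi * of_int l) - u = 2 * pi * of_int (l - k)"
      by (simp add: u_def algebra_simps)
    then have "2 * pi * \<bar>of_int (l - k)\<bar> = \<bar>(x - y + 2 * pi * of_int l) - u\<bar>"
      by (simp add: abs_mult)
    also have "\<dots> < 2 * pi"
      using k l by (simp add: u_def)
    finally have "\<bar>of_int (l - k) :: real\<bar> < 1" by simp
    then have "l = k" by linarith
    with l show False by (simp add: u_def)
  qed
  then have "x - y = 2 * pi * of_int (- k)" by (simp add: u_def)
  then show ?thesis unfolding torus_rel_def by blast
qed

instance
proof
  show "(uniformity :: (torus \<times> torus) filter) = (INF e\<in>{0 <..}. principal {(x, y). dist x y < e})"
    by (rule uniformity_torus_def)
  show "open U \<longleftrightarrow> (\<forall>x\<in>U. \<forall>\<^sub>F (x', y) in uniformity. x' = x \<longrightarrow> y \<in> U)" for U :: "torus set"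
    by (rule open_torus_def)
  show "dist x y = 0 \<longleftrightarrow> x = y" for x y :: torus
  proof
    show "x = y" if "dist x y = 0" using that by transfer (rule torus_dist_eq0)
    have "(INF k::int. \<bar>a - a + 2 * pi * of_int k\<bar>) = 0" for a :: real
    proof (rule antisym)
      show "(INF k::int. \<bar>a - a + 2 * pi * of_int k\<bar>) \<le> 0"
        using torus_dist_bdd[of "a - a"] by (rule cINF_lower2[of _ _ 0]) auto
      show "0 \<le> (INF k::int. \<bar>a - a + 2 * pi * of_int k\<bar>)"
        by (rule cINF_greatest) auto
    qed
    then have "dist y y = 0" by transfer
    then show "dist x y = 0" if "x = y" using that by simp
  qed
  show "dist x y \<le> dist x z + dist y z" for x y z :: torus
  proof transfer
    fix x y z :: real
    let ?d = "\<lambda>x y. INF k::int. \<bar>x - y + 2 * pi * of_int k\<bar>"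
    have "?d x y - \<bar>x - z + 2 * pi * of_int k\<bar> \<le> \<bar>y - z + 2 * pi * of_int l\<bar>" for k l :: int
    proof -
      have "?d x y \<le> \<bar>x - y + 2 * pi * of_int (k - l)\<bar>"
        using torus_dist_bdd[of "x - y"] by (rule cINF_lower) simp
      also have "\<dots> \<le> \<bar>x - z + 2 * pi * of_int k\<bar> + \<bar>y - z + 2 * pi * of_int l\<bar>"
        by (simp add: algebra_simps)
      finally show ?thesis by simp
    qed
    then have "?d x y - \<bar>x - z + 2 * pi * of_int k\<bar> \<le> ?d y z" for k :: int
      by (intro cINF_greatest) auto
    then have "?d x y - ?d y z \<le> \<bar>x - z + 2 * pi * of_int k\<bar>" for k :: int
      by (simp add: algebra_simps)
    then have "?d x y - ?d y z \<le> ?d x z"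
      by (intro cINF_greatest) auto
    then show "?d x y \<le> ?d x z + ?d y z" by simp
  qed
qed

end

lemma dist_torus_proj_le: "dist (torus_proj x) (torus_proj y) \<le> \<bar>x - y\<bar>"
proof transfer
  fix x y :: real
  show "(INF k::int. \<bar>x - y + 2 * pi * of_int k\<bar>) \<le> \<bar>x - y\<bar>"
    using torus_dist_bdd[of "x - y"] by (rule cINF_lower2[of _ _ 0]) auto
qed

lemma continuous_on_torus_proj: "continuous_on A torus_proj"
  unfolding continuous_on_iff
  by (metis dist_real_def dist_torus_proj_le le_less_trans)

lemma measurable_torus_proj [measurable]: "torus_proj \<in> borel_measurable borel"
  by (intro borel_measurable_continuous_onI continuous_on_torus_proj)

definition torus_uniform :: "torus measure" where
  "torus_uniform = distr (uniform_measure lborel {0..<2 * pi}) borel torus_proj"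

lemma prob_space_torus_uniform: "prob_space torus_uniform"
  unfolding torus_uniform_def
  by (intro prob_space.prob_space_distr prob_space_uniform_measure) auto

text \<open>
  In the gauge below, the case distinction is needed because \<open>0 powr 0 = 0\<close> in HOL, whereas a
  nonempty set must have \<open>0\<close>-dimensional gauge \<open>1\<close>. Coverings are required to be bounded because
  \<^const>\<open>diameter\<close> is a real number, with no meaning for unbounded sets.
\<close>

definition hausdorff_gauge :: "real \<Rightarrow> 'a::metric_space set \<Rightarrow> ennreal" where
  "hausdorff_gauge s U = (if U = {} then 0 else if s = 0 then 1 else ennreal (diameter U powr s))"

definition hausdorff_premeasure :: "real \<Rightarrow> real \<Rightarrow> 'a::metric_space set \<Rightarrow> ennreal" where
  "hausdorff_premeasure s \<delta> E =
     (INF U \<in> {U :: nat \<Rightarrow> 'a set. E \<subseteq> (\<Union>i. U i) \<and> (\<forall>i. bounded (U i) \<and> diameter (U i) \<le> \<delta>)}.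
        \<Sum>i. hausdorff_gauge s (U i))"

definition hausdorff_measure :: "real \<Rightarrow> 'a::metric_space set \<Rightarrow> ennreal" where
  "hausdorff_measure s E = (SUP \<delta>\<in>{0<..}. hausdorff_premeasure s \<delta> E)"

definition hausdorff_dim :: "'a::metric_space set \<Rightarrow> ereal" where
  "hausdorff_dim E = (INF s\<in>{s. 0 \<le> s \<and> hausdorff_measure s E = 0}. ereal s)"

definition upper_hausdorff_dim :: "'a::metric_space measure \<Rightarrow> ereal" where
  "upper_hausdorff_dim \<sigma> = (INF E\<in>{E \<in> sets borel. emeasure \<sigma> E = 1}. hausdorff_dim E)"

text \<open>Weak convergence of finite Borel measures (the library only has it for measures on \<open>\<real>\<close>).\<close>

definition weak_limit :: "(nat \<Rightarrow> 'a::metric_space measure) \<Rightarrow> 'a measure \<Rightarrow> bool" where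
  "weak_limit \<mu> \<nu> \<longleftrightarrow> finite_measure \<nu> \<and> sets \<nu> = sets borel \<and>
     (\<forall>f :: 'a \<Rightarrow> real. continuous_on UNIV f \<longrightarrow> bounded (range f) \<longrightarrow>
        (\<lambda>N. \<integral>t. f t \<partial>\<mu> N) \<longlonglongrightarrow> (\<integral>t. f t \<partial>\<nu>))"

definition bessel_I0 :: "real \<Rightarrow> real" where
  "bessel_I0 x = integral {0..2 * pi} (\<lambda>u. exp (x * cos u)) / (2 * pi)"

text \<open>
  In the following, \<open>w\<close> is one realisation of the phases \<open>(\<omega>\<^sub>n)\<close>; only \<open>w n\<close> with \<open>n \<ge> 1\<close> is used.
\<close>

definition chaos_weight :: "real \<Rightarrow> (nat \<Rightarrow> torus) \<Rightarrow> nat \<Rightarrow> torus \<Rightarrow> real" where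
  "chaos_weight \<alpha> w N t =
     (\<Prod>n=1..N. exp (\<alpha> / sqrt (real n) * torus_cos (torus_multiple n t + w n))
        / bessel_I0 (\<alpha> / sqrt (real n)))"

definition chaos_approx :: "real \<Rightarrow> torus measure \<Rightarrow> (nat \<Rightarrow> torus) \<Rightarrow> nat \<Rightarrow> torus measure" where
  "chaos_approx \<alpha> \<sigma> w N = density \<sigma> (\<lambda>t. ennreal (chaos_weight \<alpha> w N t))"

text \<open>The value is meaningful only for those \<open>w\<close> for which the weak limit exists.\<close>

definition chaos :: "real \<Rightarrow> torus measure \<Rightarrow> (nat \<Rightarrow> torus) \<Rightarrow> torus measure" where
  "chaos \<alpha> \<sigma> w = (THE \<nu>. weak_limit (chaos_approx \<alpha> \<sigma> w) \<nu>)"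

end

theory Submission
  imports Defs
begin

text \<open>
  The reason for degeneracy is that the fractional moments of the total mass tend to zero. Let
  \<open>Q\<^sub>N(t)\<close> be the weight and \<open>Y\<^sub>B(N) = \<integral>\<^sub>B Q\<^sub>N d\<sigma>\<close>, and fix \<open>0 < h < 1\<close>. At a single point the moment
  \<open>E[Q\<^sub>N(t)\<^sup>h]\<close> factorises over the independent phases into
  \<open>\<Prod> I\<^sub>0(h \<alpha>/\<surd>k) / I\<^sub>0(\<alpha>/\<surd>k)\<^sup>h\<close>; because \<open>I\<^sub>0(x) = 1 + x\<^sup>2/4 + O(x^4)\<close>, this product is of the order
  \<open>N\<close> to the power \<open>- h(1 - h)\<alpha>\<^sup>2/4\<close>.

  The same bound holds for a whole ball \<open>B\<close> of radius \<open>1/n\<close> around \<open>t\<^sub>0\<close>, with the additional factor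
  \<open>\<sigma>(B)\<^sup>h\<close> (\<open>chaos_mass_small_ball\<close>). The weights at two points of the ball are not uniformly
  comparable, since the sum of the oscillations of the exponents over \<open>k \<le> n\<close> is of order \<open>\<surd>n\<close>. What
  is bounded is the expected ratio \<open>Q\<^sub>n(t)/Q\<^sub>n(t\<^sub>0)\<close> under the law tilted by \<open>Q\<^sub>n(t\<^sub>0)\<^sup>h\<close>: a combination
  of two cosines with the same frequency is again a cosine, and a phase difference \<open>\<theta>\<close> raises its
  squared amplitude only by a quantity of order \<open>\<theta>\<^sup>2\<close>, so that the phase \<open>k\<close> adds at most \<open>\<alpha>\<^sup>2 k/n\<^sup>2\<close> to the exponent
  (\<open>tilted_phase_le\<close>, \<open>tilted_weight_le\<close>). The tangent to the concave function \<open>y \<mapsto> y\<^sup>h\<close> at the random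
  point \<open>\<sigma>(B) Q\<^sub>n(t\<^sub>0)\<close> then reduces the moment of the ball to such expectations.

  If \<open>\<sigma>\<close> is carried by a set of vanishing \<open>s\<close>-dimensional measure with \<open>0 < s < \<alpha>\<^sup>2/4\<close>, choose
  \<open>h = 4s/\<alpha>\<^sup>2\<close>, which makes the decay exponent equal to \<open>(1 - h)s\<close>. Covering by balls of radius
  \<open>r\<^sub>i\<close> with \<open>\<Sum> r\<^sub>i\<^sup>s \<le> \<eta>\<close> and using subadditivity of \<open>y \<mapsto> y\<^sup>h\<close>, the moment of the mass is bounded by
  \<open>\<Sum> \<sigma>(B\<^sub>i)\<^sup>h (r\<^sub>i\<^sup>s)\<close> with the second factor raised to \<open>1 - h\<close>, hence, by Hoelder's inequality, by a
  constant times \<open>\<eta>\<close> to the power \<open>1 - h\<close> (\<open>chaos_mass_powr_small\<close>).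

  Since \<open>Y(N)\<^sup>h\<close> is a nonnegative supermartingale, moments on different balls, which are naturally
  estimated at different times \<open>n\<^sub>i\<close>, may be compared at one common later time, and the maximal
  inequality turns convergence of the moments into almost sure convergence of the mass to zero
  (\<open>chaos_mass_tendsto_0\<close>). Vanishing total mass forces the weak limit to exist and to be zero. For
  \<open>|\<alpha>| > 2\<close> the argument applies to every \<open>\<sigma>\<close>, because the circle itself has vanishing \<open>s\<close>-dimensional
  measure for every \<open>s > 1\<close>.
\<close>

section \<open>The circle and its uniform measure\<close>

text \<open>
  Together with the cosine this gives the addition formula on the circle, which separates
  \<open>cos (kt + u)\<close> into functions of \<open>t\<close> and of \<open>u\<close>: joint measurability then needs no analysis of the
  Borel sets of a product of two circles.
\<close>

lift_definition torus_sin :: "torus \<Rightarrow> real" is sin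
proof -
  fix x y assume "torus_rel x y"
  then obtain k :: int where "x = y + 2 * pi * of_int k"
    by (auto simp: torus_rel_def algebra_simps)
  then show "sin x = sin y"
    by (simp add: sin_add)
qed

lemma torus_cos_proj [simp]: "torus_cos (torus_proj x) = cos x"
  by transfer simp

lemma torus_sin_proj [simp]: "torus_sin (torus_proj x) = sin x"
  by transfer simp

lemma torus_multiple_proj: "torus_multiple n (torus_proj x) = torus_proj (real n * x)"
  by transfer (rule torus_rel_refl)

lemma torus_proj_add: "torus_proj x + torus_proj y = torus_proj (x + y)"
  by transfer (rule torus_rel_refl)

lemma torus_proj_surj: obtains x where "t = torus_proj x"
  by (metis Quotient_torus Quotient_abs_rep torus_proj.abs_eq)

lemma torus_cos_add: "torus_cos (s + t) = torus_cos s * torus_cos t - torus_sin s * torus_sin t"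
  by transfer (rule cos_add)

lemma torus_sin_cos_squared [simp]: "(torus_sin t)\<^sup>2 + (torus_cos t)\<^sup>2 = 1"
  by transfer simp

lemma abs_torus_cos_le_one [simp]: "\<bar>torus_cos t\<bar> \<le> 1"
  by transfer simp

text \<open>
  The circle distance is the infimum of the distances of all pairs of representatives, so a lower
  bound valid for every pair is a lower bound for the distance.
\<close>

lemma torus_le_dist:
  assumes "\<And>x y. s = torus_proj x \<Longrightarrow> t = torus_proj y \<Longrightarrow> c \<le> \<bar>x - y\<bar>"
  shows "c \<le> dist s t"
proof -
  obtain x y where xy: "s = torus_proj x" "t = torus_proj y"
    by (metis torus_proj_surj)
  have "c \<le> \<bar>x - y + 2 * pi * of_int k\<bar>" for k :: int
  proof -
    have "torus_proj (x + 2 * pi * of_int k) = torus_proj x"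
      by transfer (auto simp: torus_rel_def)
    with assms[of "x + 2 * pi * of_int k" y] xy show ?thesis
      by (simp add: algebra_simps)
  qed
  then have "c \<le> (INF k::int. \<bar>x - y + 2 * pi * of_int k\<bar>)"
    by (intro cINF_greatest) auto
  moreover have "dist (torus_proj x) (torus_proj y) = (INF k::int. \<bar>x - y + 2 * pi * of_int k\<bar>)"
    by transfer simp
  ultimately show ?thesis
    by (simp add: xy)
qed

lemma real_sin_lipschitz: "\<bar>sin x - sin y\<bar> \<le> \<bar>x - y :: real\<bar>"
proof -
  have "sin x - sin y = 2 * sin ((x - y) / 2) * cos ((x + y) / 2)"
    by (rule sin_diff_sin)
  then have "\<bar>sin x - sin y\<bar> = 2 * \<bar>sin ((x - y) / 2)\<bar> * \<bar>cos ((x + y) / 2)\<bar>"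
    by (simp add: abs_mult)
  also have "\<dots> \<le> 2 * \<bar>(x - y) / 2\<bar> * 1"
    by (intro mult_mono mult_left_mono abs_sin_x_le_abs_x) auto
  finally show ?thesis by simp
qed

lemma torus_sin_lipschitz: "\<bar>torus_sin s - torus_sin t\<bar> \<le> dist s t"
  by (rule torus_le_dist) (auto simp: real_sin_lipschitz)

lemma torus_cos_lipschitz: "\<bar>torus_cos s - torus_cos t\<bar> \<le> dist s t"
proof (rule torus_le_dist)
  fix x y assume "s = torus_proj x" "t = torus_proj y"
  then show "\<bar>torus_cos s - torus_cos t\<bar> \<le> \<bar>x - y\<bar>"
    using real_sin_lipschitz[of "x + pi / 2" "y + pi / 2"] by (simp add: sin_add)
qed

lemma continuous_on_lipschitz:
  fixes f :: "'a::metric_space \<Rightarrow> 'b::metric_space"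
  assumes "\<And>s t. dist (f s) (f t) \<le> L * dist s t"
  shows "continuous_on A f"
proof (rule lipschitz_on_continuous_on)
  show "(max L 0)-lipschitz_on A f"
    proof (rule lipschitz_onI)
    fix s t :: "'a"
    have "L * dist s t \<le> max L 0 * dist s t"
      by (intro mult_right_mono) auto
    with assms[of s t] show "dist (f s) (f t) \<le> max L 0 * dist s t" by linarith
  qed simp
qed

lemma measurable_torus_cos [measurable]: "torus_cos \<in> borel_measurable borel"
  by (intro borel_measurable_continuous_onI continuous_on_lipschitz[where L = 1])
     (simp add: dist_real_def torus_cos_lipschitz)

lemma measurable_torus_sin [measurable]: "torus_sin \<in> borel_measurable borel"
  by (intro borel_measurable_continuous_onI continuous_on_lipschitz[where L = 1])
     (simp add: dist_real_def torus_sin_lipschitz)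

lemma measurable_torus_multiple [measurable]: "torus_multiple n \<in> borel_measurable borel"
proof (intro borel_measurable_continuous_onI continuous_on_lipschitz[where L = "real n"])
  fix s t
  show "dist (torus_multiple n s) (torus_multiple n t) \<le> real n * dist s t"
  proof (cases "n = 0")
    case True
    then show ?thesis
      by (metis dist_self mult_zero_left of_nat_0 order_refl torus_multiple_proj torus_proj_surj)
  next
    case False
    have "dist (torus_multiple n s) (torus_multiple n t) / real n \<le> dist s t"
    proof (rule torus_le_dist)
      fix x y assume "s = torus_proj x" "t = torus_proj y"
      then have "dist (torus_multiple n s) (torus_multiple n t) \<le> \<bar>real n * x - real n * y\<bar>"
        by (simp add: torus_multiple_proj dist_torus_proj_le)
      also have "\<dots> = real n * \<bar>x - y\<bar>"
        by (simp flip: right_diff_distrib add: abs_mult)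
      finally show "dist (torus_multiple n s) (torus_multiple n t) / real n \<le> \<bar>x - y\<bar>"
        using False by (simp add: field_simps)
    qed
    with False show ?thesis by (simp add: field_simps)
  qed
qed

lemma measurable_torus_add [measurable]: "(\<lambda>u. u + s :: torus) \<in> borel_measurable borel"
proof (intro borel_measurable_continuous_onI continuous_on_lipschitz[where L = 1])
  fix u v :: torus
  show "dist (u + s) (v + s) \<le> 1 * dist u v"
    by (transfer) simp
qed

lemma one_minus_cos_le: "2 * (1 - cos x) \<le> (x::real)\<^sup>2"
proof -
  have "2 * (1 - cos x) = 4 * (sin (x / 2))\<^sup>2"
    using cos_double_sin[of "x / 2"] by simp
  also have "(sin (x / 2))\<^sup>2 \<le> (x / 2)\<^sup>2"
    using abs_sin_x_le_abs_x[of "x / 2"] by (rule abs_le_square_iff[THEN iffD1])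
  finally show ?thesis by (simp add: power_divide)
qed

text \<open>
  The quantity \<open>c n s t\<close> is \<open>cos (n(s - t))\<close>; written with the addition formula, it is in the form in
  which the squared amplitude of a sum of two cosines presents it.
\<close>

lemma torus_cos_multiple_diff:
  defines "c \<equiv> (\<lambda>n s t. torus_cos (torus_multiple n s) * torus_cos (torus_multiple n t)
              + torus_sin (torus_multiple n s) * torus_sin (torus_multiple n t))"
  shows "2 * (1 - c n s t) \<le> (real n * dist s t)\<^sup>2"
proof (cases "n = 0")
  case True
  then show ?thesis
    by (cases s rule: torus_proj_surj, cases t rule: torus_proj_surj)
       (simp add: c_def torus_multiple_proj)
next
  case False
  have "sqrt (2 * (1 - c n s t)) / real n \<le> dist s t"
  proof (rule torus_le_dist)
    fix x y assume "s = torus_proj x" "t = torus_proj y"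
    then have "c n s t = cos (real n * (x - y))"
      by (simp add: c_def torus_multiple_proj cos_diff right_diff_distrib)
    then have "sqrt (2 * (1 - c n s t)) \<le> sqrt ((real n * (x - y))\<^sup>2)"
      using one_minus_cos_le by (simp only: real_sqrt_le_iff)
    then show "sqrt (2 * (1 - c n s t)) / real n \<le> \<bar>x - y\<bar>"
      using False by (simp add: abs_mult pos_divide_le_eq mult.commute)
  qed
  then have "sqrt (2 * (1 - c n s t)) \<le> real n * dist s t"
    using False by (simp add: field_simps)
  then show ?thesis
    by (rule sqrt_le_D)
qed

lemma sets_torus_uniform [simp, measurable_cong]: "sets torus_uniform = sets borel"
  by (simp add: torus_uniform_def)

lemma space_torus_uniform [simp]: "space torus_uniform = UNIV"
  by (simp add: torus_uniform_def)

interpretation torus_uniform: prob_space torus_uniform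
  by (rule prob_space_torus_uniform)

lemma nn_integral_torus_uniform:
  assumes [measurable]: "f \<in> borel_measurable borel"
  shows "(\<integral>\<^sup>+u. f u \<partial>torus_uniform)
    = (\<integral>\<^sup>+x. f (torus_proj x) * indicator {0..<2 * pi} x \<partial>lborel) / ennreal (2 * pi)"
  unfolding torus_uniform_def
  by (subst nn_integral_distr, simp_all, subst nn_integral_uniform_measure) (simp_all)

text \<open>
  The part of the shifted interval that sticks out beyond \<open>p\<close> is moved back by one period.
\<close>

lemma nn_integral_periodic_shift:
  fixes g :: "real \<Rightarrow> ennreal"
  assumes [measurable]: "g \<in> borel_measurable borel"
    and per: "\<And>x. g (x + p) = g x" and c: "0 \<le> c" "c \<le> p"
  shows "(\<integral>\<^sup>+x. g (x + c) * indicator {0..<p} x \<partial>lborel)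
       = (\<integral>\<^sup>+x. g x * indicator {0..<p} x \<partial>lborel)"
proof -
  have shift: "(\<integral>\<^sup>+x. f x \<partial>lborel) = (\<integral>\<^sup>+x. f (x + a) \<partial>lborel)"
    if "f \<in> borel_measurable borel" for f :: "real \<Rightarrow> ennreal" and a
    using nn_integral_real_affine[OF that, of 1 a] by (simp add: add.commute)
  have "(\<integral>\<^sup>+x. g (x + c) * indicator {0..<p} x \<partial>lborel)
      = (\<integral>\<^sup>+x. g x * indicator {c..<p + c} x \<partial>lborel)"
    by (subst shift[where a = c and f = "\<lambda>x. g x * indicator {c..<p + c} x"])
       (auto intro!: nn_integral_cong simp: indicator_def)
  also have "\<dots> = (\<integral>\<^sup>+x. g x * indicator {c..<p} x + g x * indicator {p..<p + c} x \<partial>lborel)"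
    using c by (intro nn_integral_cong) (auto simp: indicator_def)
  also have "\<dots> = (\<integral>\<^sup>+x. g x * indicator {c..<p} x \<partial>lborel)
      + (\<integral>\<^sup>+x. g x * indicator {p..<p + c} x \<partial>lborel)"
    by (rule nn_integral_add) auto
  also have "(\<integral>\<^sup>+x. g x * indicator {p..<p + c} x \<partial>lborel)
      = (\<integral>\<^sup>+x. g x * indicator {0..<c} x \<partial>lborel)"
    by (subst shift[where a = p]) (auto intro!: nn_integral_cong simp: indicator_def per)
  also have "(\<integral>\<^sup>+x. g x * indicator {c..<p} x \<partial>lborel) + (\<integral>\<^sup>+x. g x * indicator {0..<c} x \<partial>lborel)
      = (\<integral>\<^sup>+x. g x * indicator {c..<p} x + g x * indicator {0..<c} x \<partial>lborel)"
    by (rule nn_integral_add[symmetric]) auto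
  also have "\<dots> = (\<integral>\<^sup>+x. g x * indicator {0..<p} x \<partial>lborel)"
    using c by (intro nn_integral_cong) (auto simp: indicator_def)
  finally show ?thesis .
qed

lemma torus_proj_surj_fundamental:
  obtains c where "0 \<le> c" "c < 2 * pi" "t = torus_proj c"
proof -
  obtain x where x: "t = torus_proj x" by (rule torus_proj_surj)
  define c where "c = 2 * pi * frac (x / (2 * pi))"
  have "c = x - 2 * pi * of_int \<lfloor>x / (2 * pi)\<rfloor>"
    by (simp add: c_def frac_def algebra_simps)
  then have "torus_proj c = torus_proj x"
    by transfer (auto simp: torus_rel_def intro!: exI[of _ "- \<lfloor>x / (2 * pi)\<rfloor>" for x :: real])
  moreover have "0 \<le> c" "c < 2 * pi"
    using frac_lt_1[of "x / (2 * pi)"] by (auto simp: c_def mult_less_cancel_left1)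
  ultimately show ?thesis using x that by metis
qed

lemma torus_uniform_shift: "distr torus_uniform borel (\<lambda>u. u + s) = torus_uniform"
proof (rule measure_eqI)
  show "sets (distr torus_uniform borel (\<lambda>u. u + s)) = sets torus_uniform" by simp
  fix A assume "A \<in> sets (distr torus_uniform borel (\<lambda>u. u + s))"
  then have [measurable]: "A \<in> sets borel" by simp
  obtain c where c: "0 \<le> c" "c < 2 * pi" "s = torus_proj c"
    by (rule torus_proj_surj_fundamental)
  have per: "torus_proj (x + 2 * pi) = torus_proj x" for x
    by transfer (auto simp: torus_rel_def intro: exI[of _ 1])
  have "emeasure (distr torus_uniform borel (\<lambda>u. u + s)) A
      = (\<integral>\<^sup>+u. indicator A (u + s) \<partial>torus_uniform)"
    by (subst nn_integral_indicator[symmetric], simp, subst nn_integral_distr) auto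
  also have "\<dots> = (\<integral>\<^sup>+u. indicator A u \<partial>torus_uniform)"
    using nn_integral_periodic_shift[of "\<lambda>x. indicator A (torus_proj x)" "2 * pi" c] c per
    by (simp add: nn_integral_torus_uniform torus_proj_add del: nn_integral_indicator)
  finally show "emeasure (distr torus_uniform borel (\<lambda>u. u + s)) A = emeasure torus_uniform A"
    by simp
qed

lemma integral_torus_uniform_shift:
  fixes f :: "torus \<Rightarrow> real"
  assumes "f \<in> borel_measurable borel"
  shows "(\<integral>u. f (u + s) \<partial>torus_uniform) = (\<integral>u. f u \<partial>torus_uniform)"
  using assms by (subst (2) torus_uniform_shift[of s, symmetric], subst integral_distr) auto

section \<open>The Bessel function \<open>I\<^sub>0\<close>\<close>

lemma integrable_torus_uniform_bounded:
  fixes f :: "torus \<Rightarrow> real"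
  assumes "f \<in> borel_measurable borel" "\<And>u. \<bar>f u\<bar> \<le> B"
  shows "integrable torus_uniform f"
  by (rule torus_uniform.integrable_const_bound[where B = B]) (use assms in auto)

lemma abs_mult_torus_cos_le: "\<bar>x * torus_cos u\<bar> \<le> \<bar>x\<bar>"
  by (simp add: abs_mult mult_left_le)

lemma integrable_exp_cos: "integrable torus_uniform (\<lambda>u. exp (x * torus_cos u))"
proof (rule integrable_torus_uniform_bounded)
  fix u show "\<bar>exp (x * torus_cos u)\<bar> \<le> exp \<bar>x\<bar>"
    using abs_mult_torus_cos_le[of x u] by simp
qed simp

lemma bessel_I0_eq_integral: "bessel_I0 x = (\<integral>u. exp (x * torus_cos u) \<partial>torus_uniform)"
proof -
  let ?f = "\<lambda>y::real. exp (x * cos y)"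
  have f: "(?f has_integral integral {0..2 * pi} ?f) {0..2 * pi}"
    by (intro integrable_integral integrable_continuous_real continuous_intros)
  have "ennreal (integral {0..2 * pi} ?f) = (\<integral>\<^sup>+y. ennreal (?f y) * indicator {0..2 * pi} y \<partial>lborel)"
    by (rule nn_integral_has_integral_lebesgue'[OF _ f, symmetric]) simp
  also have "\<dots> = (\<integral>\<^sup>+y. ennreal (?f y) * indicator {0..<2 * pi} y \<partial>lborel)"
    using AE_lborel_singleton[of "2 * pi"]
    by (intro nn_integral_cong_AE) (auto simp: indicator_def elim!: eventually_mono)
  finally have "(\<integral>\<^sup>+u. ennreal (exp (x * torus_cos u)) \<partial>torus_uniform)
      = ennreal (integral {0..2 * pi} ?f) / ennreal (2 * pi)"
    by (simp add: nn_integral_torus_uniform)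
  also have "\<dots> = ennreal (bessel_I0 x)"
    by (simp add: bessel_I0_def divide_ennreal integral_nonneg integrable_continuous_real continuous_intros)
  finally have "ennreal (\<integral>u. exp (x * torus_cos u) \<partial>torus_uniform) = ennreal (bessel_I0 x)"
    by (subst nn_integral_eq_integral[symmetric])
       (auto intro!: integrable_exp_cos)
  moreover have "0 \<le> bessel_I0 x"
    by (auto simp: bessel_I0_def intro!: divide_nonneg_pos integral_nonneg integrable_continuous_real continuous_intros)
  ultimately show ?thesis
    by (simp add: integral_nonneg_AE)
qed

lemma torus_cos_add_pi: "torus_cos (u + torus_proj pi) = - torus_cos u"
  by (simp add: torus_cos_add)

lemma integrable_cosh_cos: "integrable torus_uniform (\<lambda>u. cosh (x * torus_cos u))"
  unfolding cosh_def
  using integrable_exp_cos[of x] integrable_exp_cos[of "-x"] by simp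

text \<open>
  The uniform law is invariant under the half turn, which changes the sign of the cosine. The even
  integrand makes the dependence of \<open>I\<^sub>0(x)\<close> on \<open>x\<^sup>2\<close> visible, so that pointwise inequalities for
  \<open>cosh\<close> replace the power series.
\<close>

lemma bessel_I0_eq_cosh: "bessel_I0 x = (\<integral>u. cosh (x * torus_cos u) \<partial>torus_uniform)"
proof -
  have "bessel_I0 x = (\<integral>u. exp (- x * torus_cos u) \<partial>torus_uniform)"
    using integral_torus_uniform_shift[of "\<lambda>u. exp (x * torus_cos u)" "torus_proj pi"]
    by (simp add: torus_cos_add_pi bessel_I0_eq_integral)
  then have "2 * bessel_I0 x
      = (\<integral>u. exp (x * torus_cos u) \<partial>torus_uniform) + (\<integral>u. exp (- x * torus_cos u) \<partial>torus_uniform)"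
    by (simp add: bessel_I0_eq_integral)
  also have "\<dots> = (\<integral>u. 2 * cosh (x * torus_cos u) \<partial>torus_uniform)"
    by (subst Bochner_Integration.integral_add[symmetric])
       (use integrable_exp_cos[of x] integrable_exp_cos[of "-x"] in
         \<open>auto simp: cosh_def intro!: Bochner_Integration.integral_cong\<close>)
  finally show ?thesis by simp
qed

text \<open>
  A quarter turn exchanges \<open>cos\<^sup>2\<close> and \<open>sin\<^sup>2\<close>, whose sum is \<open>1\<close>.
\<close>

lemma integral_torus_cos_squared: "(\<integral>u. (torus_cos u)\<^sup>2 \<partial>torus_uniform) = 1 / 2"
proof -
  have int: "integrable torus_uniform (\<lambda>u. (torus_cos u)\<^sup>2)"
    by (rule integrable_torus_uniform_bounded[where B = 1]) (auto simp: abs_square_le_1)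
  have int': "integrable torus_uniform (\<lambda>u. (torus_sin u)\<^sup>2)"
  proof (rule integrable_torus_uniform_bounded[where B = 1])
    fix u show "\<bar>(torus_sin u)\<^sup>2\<bar> \<le> 1"
      using torus_sin_cos_squared[of u] zero_le_power2[of "torus_cos u"]
      unfolding abs_power2 by linarith
  qed simp
  have "(\<integral>u. (torus_cos u)\<^sup>2 \<partial>torus_uniform) = (\<integral>u. (torus_sin u)\<^sup>2 \<partial>torus_uniform)"
    using integral_torus_uniform_shift[of "\<lambda>u. (torus_cos u)\<^sup>2" "torus_proj (pi / 2)"]
    by (simp add: torus_cos_add)
  moreover have "(\<integral>u. (torus_sin u)\<^sup>2 \<partial>torus_uniform) + (\<integral>u. (torus_cos u)\<^sup>2 \<partial>torus_uniform) = 1"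
    using int int' by (subst Bochner_Integration.integral_add[symmetric])
      (auto simp: torus_uniform.prob_space[simplified])
  ultimately show ?thesis by simp
qed

lemma cosh_lower: "1 + z\<^sup>2 / 2 \<le> cosh (z::real)"
proof -
  have sinh_ge: "x \<le> sinh x" if "0 \<le> x" for x :: real
  proof -
    have "sinh 0 - 0 \<le> sinh x - x"
    proof (rule DERIV_nonneg_imp_nondecreasing[OF that])
      fix y :: real
      have "((\<lambda>x. sinh x - x) has_real_derivative (cosh y - 1)) (at y)"
        by (auto intro!: derivative_eq_intros)
      then show "\<exists>d. ((\<lambda>x. sinh x - x) has_real_derivative d) (at y) \<and> 0 \<le> d"
        using cosh_real_ge_1[of y] by (intro exI[of _ "cosh y - 1"]) simp
    qed
    then show ?thesis by simp
  qed
  have "cosh 0 - 0\<^sup>2 / 2 \<le> cosh \<bar>z\<bar> - \<bar>z\<bar>\<^sup>2 / 2"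
  proof (rule DERIV_nonneg_imp_nondecreasing[of 0 "\<bar>z\<bar>" "\<lambda>x. cosh x - x\<^sup>2 / 2"])
    fix y :: real assume "0 \<le> y"
    have "((\<lambda>x. cosh x - x\<^sup>2 / 2) has_real_derivative (sinh y - y)) (at y)"
      by (auto intro!: derivative_eq_intros)
    then show "\<exists>d. ((\<lambda>x. cosh x - x\<^sup>2 / 2) has_real_derivative d) (at y) \<and> 0 \<le> d"
      using sinh_ge[OF \<open>0 \<le> y\<close>] by (intro exI[of _ "sinh y - y"]) simp
  qed simp
  then show ?thesis by simp
qed

text \<open>
  The function \<open>ln (cosh x) - x\<^sup>2/2\<close> decreases for \<open>x \<ge> 0\<close>, its derivative being \<open>tanh x - x\<close>.
\<close>

lemma cosh_ratio_le:
  fixes a b :: real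
  assumes "a\<^sup>2 \<le> b\<^sup>2"
  shows "cosh b \<le> cosh a * exp ((b\<^sup>2 - a\<^sup>2) / 2)"
proof -
  have tanh_le: "tanh x \<le> x" if "0 \<le> x" for x :: real
  proof -
    have "x - tanh x \<ge> 0 - tanh 0"
    proof (rule DERIV_nonneg_imp_nondecreasing[of 0 x "\<lambda>x. x - tanh x"])
      fix y :: real assume "0 \<le> y" "y \<le> x"
      have "((\<lambda>x. x - tanh x) has_real_derivative (tanh y)\<^sup>2) (at y)"
        by (auto intro!: derivative_eq_intros simp: power2_eq_square)
      then show "\<exists>d. ((\<lambda>x. x - tanh x) has_real_derivative d) (at y) \<and> 0 \<le> d"
        by (intro exI[of _ "(tanh y)\<^sup>2"]) simp
    qed (use that in auto)
    then show ?thesis by simp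
  qed
  have "ln (cosh \<bar>b\<bar>) - \<bar>b\<bar>\<^sup>2 / 2 \<le> ln (cosh \<bar>a\<bar>) - \<bar>a\<bar>\<^sup>2 / 2"
  proof (rule DERIV_nonpos_imp_nonincreasing[of "\<bar>a\<bar>" "\<bar>b\<bar>" "\<lambda>x. ln (cosh x) - x\<^sup>2 / 2"])
    show "\<bar>a\<bar> \<le> \<bar>b\<bar>" using assms by (simp add: abs_le_square_iff)
    fix y assume "\<bar>a\<bar> \<le> y" "y \<le> \<bar>b\<bar>"
    then have "0 \<le> y" by linarith
    moreover have "((\<lambda>x. ln (cosh x) - x\<^sup>2 / 2) has_real_derivative (tanh y - y)) (at y)"
      by (auto intro!: derivative_eq_intros simp: tanh_def cosh_real_pos)
    ultimately show "\<exists>d. ((\<lambda>x. ln (cosh x) - x\<^sup>2 / 2) has_real_derivative d) (at y) \<and> d \<le> 0"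
      using tanh_le by (intro exI[of _ "tanh y - y"]) simp
  qed
  then have "ln (cosh b) \<le> ln (cosh a) + (b\<^sup>2 - a\<^sup>2) / 2"
    by (simp add: diff_divide_distrib)
  then have "exp (ln (cosh b)) \<le> exp (ln (cosh a) + (b\<^sup>2 - a\<^sup>2) / 2)"
    by (simp only: exp_le_cancel_iff)
  then show ?thesis by (simp add: exp_add cosh_real_pos)
qed

lemma bessel_I0_ge: "1 + x\<^sup>2 / 4 \<le> bessel_I0 x"
proof -
  have int: "integrable torus_uniform (\<lambda>u. (torus_cos u)\<^sup>2)"
    by (rule integrable_torus_uniform_bounded[where B = 1]) (auto simp: abs_square_le_1)
  have "1 + x\<^sup>2 / 4 = (\<integral>u. 1 + x\<^sup>2 / 2 * (torus_cos u)\<^sup>2 \<partial>torus_uniform)"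
    using int by (simp add: integral_torus_cos_squared torus_uniform.prob_space[simplified])
  also have "\<dots> \<le> bessel_I0 x"
    unfolding bessel_I0_eq_cosh
    using int cosh_lower[of "x * torus_cos u" for u]
    by (intro integral_mono integrable_cosh_cos) (auto simp: power_mult_distrib)
  finally show ?thesis .
qed

lemma bessel_I0_pos: "0 < bessel_I0 x"
  using bessel_I0_ge[of x] zero_le_power2[of x] by linarith

lemma bessel_I0_ge_one: "1 \<le> bessel_I0 x"
  using bessel_I0_ge[of x] zero_le_power2[of x] by linarith

text \<open>
  This controls the growth of \<open>I\<^sub>0\<close> in terms of the squared argument. The exact rate of
  \<open>ln I\<^sub>0\<close> in \<open>x\<^sup>2\<close> near zero is \<open>1/4\<close>; the rate \<open>1/2\<close> already holds under the integral sign,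
  and it only influences a constant.
\<close>

lemma bessel_I0_ratio_le:
  assumes "a\<^sup>2 \<le> b\<^sup>2"
  shows "bessel_I0 b \<le> bessel_I0 a * exp ((b\<^sup>2 - a\<^sup>2) / 2)"
proof -
  have "cosh (b * torus_cos u) \<le> cosh (a * torus_cos u) * exp ((b\<^sup>2 - a\<^sup>2) / 2)" for u
  proof -
    have c: "(torus_cos u)\<^sup>2 \<le> 1" by (simp add: abs_square_le_1)
    have "cosh (b * torus_cos u)
        \<le> cosh (a * torus_cos u) * exp (((b * torus_cos u)\<^sup>2 - (a * torus_cos u)\<^sup>2) / 2)"
      using assms by (intro cosh_ratio_le) (simp add: power_mult_distrib mult_right_mono)
    also have "(b * torus_cos u)\<^sup>2 - (a * torus_cos u)\<^sup>2 = (b\<^sup>2 - a\<^sup>2) * (torus_cos u)\<^sup>2"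
      by (simp add: power_mult_distrib algebra_simps)
    also have "(b\<^sup>2 - a\<^sup>2) * (torus_cos u)\<^sup>2 \<le> b\<^sup>2 - a\<^sup>2"
      using assms c by (simp add: mult_left_le)
    finally show ?thesis by (simp add: cosh_real_nonneg)
  qed
  then have "bessel_I0 b \<le> (\<integral>u. cosh (a * torus_cos u) * exp ((b\<^sup>2 - a\<^sup>2) / 2) \<partial>torus_uniform)"
    unfolding bessel_I0_eq_cosh using integrable_cosh_cos
    by (intro integral_mono) auto
  also have "\<dots> = bessel_I0 a * exp ((b\<^sup>2 - a\<^sup>2) / 2)"
    unfolding bessel_I0_eq_cosh by simp
  finally show ?thesis .
qed

text \<open>
  From \<open>cosh z \<le> exp y\<close> with \<open>y = z\<^sup>2/2\<close>, and twice \<open>exp y - 1 \<le> y exp y\<close>.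
\<close>

lemma cosh_upper: "cosh z \<le> 1 + z\<^sup>2 / 2 + z ^ 4 * exp ((z::real)\<^sup>2 / 2)"
proof -
  define y where "y = z\<^sup>2 / 2"
  have y: "0 \<le> y" by (simp add: y_def)
  have "exp y * (1 - y) \<le> exp y * exp (- y)"
    using exp_ge_add_one_self[of "- y"] by (intro mult_left_mono) auto
  then have *: "exp y - 1 \<le> y * exp y"
    by (simp add: algebra_simps flip: exp_add)
  have "cosh z \<le> exp y"
    using cosh_ratio_le[of 0 z] by (simp add: y_def)
  also have "\<dots> \<le> 1 + y + y * (exp y - 1)"
    using * by (simp add: algebra_simps)
  also have "\<dots> \<le> 1 + y + y * (y * exp y)"
    using * y by (intro add_left_mono mult_left_mono)
  also have "\<dots> = 1 + y + z ^ 4 / 4 * exp y"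
    by (simp add: y_def power2_eq_square power4_eq_xxxx)
  also have "\<dots> \<le> 1 + y + z ^ 4 * exp y"
    by simp
  finally show ?thesis by (simp add: y_def)
qed

text \<open>
  Here the second-order coefficient \<open>1/4\<close> has to be exact, since it determines the decay exponent
  and with it the critical dimension.
\<close>

lemma bessel_I0_le: "bessel_I0 x \<le> exp (x\<^sup>2 / 4 + x ^ 4 * exp (x\<^sup>2 / 2))"
proof -
  have int: "integrable torus_uniform (\<lambda>u. (torus_cos u)\<^sup>2)"
    by (rule integrable_torus_uniform_bounded[where B = 1]) (auto simp: abs_square_le_1)
  have "cosh (x * torus_cos u) \<le> 1 + x\<^sup>2 / 2 * (torus_cos u)\<^sup>2 + x ^ 4 * exp (x\<^sup>2 / 2)" for u
  proof -
    have "(x * torus_cos u) ^ 4 \<le> x ^ 4" "(x * torus_cos u)\<^sup>2 \<le> x\<^sup>2"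
      using abs_mult_torus_cos_le[of x u] power_mono[of "\<bar>x * torus_cos u\<bar>" "\<bar>x\<bar>" 4]
        power_mono[of "\<bar>x * torus_cos u\<bar>" "\<bar>x\<bar>" 2] by simp_all
    then have "(x * torus_cos u) ^ 4 * exp ((x * torus_cos u)\<^sup>2 / 2) \<le> x ^ 4 * exp (x\<^sup>2 / 2)"
      by (intro mult_mono) auto
    then show ?thesis
      using cosh_upper[of "x * torus_cos u"] by (simp add: power_mult_distrib)
  qed
  then have "bessel_I0 x \<le> (\<integral>u. 1 + x\<^sup>2 / 2 * (torus_cos u)\<^sup>2 + x ^ 4 * exp (x\<^sup>2 / 2) \<partial>torus_uniform)"
    unfolding bessel_I0_eq_cosh using int
    by (intro integral_mono integrable_cosh_cos) auto
  also have "\<dots> = 1 + (x\<^sup>2 / 4 + x ^ 4 * exp (x\<^sup>2 / 2))"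
    using int by (simp add: integral_torus_cos_squared torus_uniform.prob_space[simplified])
  also have "\<dots> \<le> exp (x\<^sup>2 / 4 + x ^ 4 * exp (x\<^sup>2 / 2))"
    by (rule exp_ge_add_one_self)
  finally show ?thesis .
qed

text \<open>
  A combination of two cosines of the same frequency is one cosine, with amplitude given by the law
  of cosines and with a phase that the uniform law does not see.
\<close>

lemma integral_exp_two_cos:
  assumes "A\<^sup>2 + B\<^sup>2 + 2 * A * B * (torus_cos p * torus_cos q + torus_sin p * torus_sin q) = \<rho>\<^sup>2"
  shows "(\<integral>u. exp (A * torus_cos (p + u) + B * torus_cos (q + u)) \<partial>torus_uniform) = bessel_I0 \<rho>"
proof -
  define X where "X = A * torus_cos p + B * torus_cos q"
  define Y where "Y = A * torus_sin p + B * torus_sin q"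
  obtain r \<phi> where r: "X = r * cos \<phi>" "Y = r * sin \<phi>"
    using polar_Ex by blast
  have "r\<^sup>2 = X\<^sup>2 + Y\<^sup>2"
    using sin_cos_squared_add[of \<phi>] by (simp add: r power_mult_distrib flip: distrib_left)
  also have "\<dots> = A\<^sup>2 * ((torus_sin p)\<^sup>2 + (torus_cos p)\<^sup>2) + B\<^sup>2 * ((torus_sin q)\<^sup>2 + (torus_cos q)\<^sup>2)
      + 2 * A * B * (torus_cos p * torus_cos q + torus_sin p * torus_sin q)"
    unfolding X_def Y_def by (simp add: power2_eq_square algebra_simps)
  finally have "r\<^sup>2 = \<rho>\<^sup>2"
    using assms by simp
  then have "\<bar>r\<bar> = \<bar>\<rho>\<bar>"
    by (simp add: power2_eq_iff abs_eq_iff)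
  have "cosh (r * torus_cos u) = cosh (\<rho> * torus_cos u)" for u
    using \<open>\<bar>r\<bar> = \<bar>\<rho>\<bar>\<close> by (metis abs_mult cosh_real_abs)
  then have rho: "bessel_I0 r = bessel_I0 \<rho>"
    unfolding bessel_I0_eq_cosh by presburger
  have "A * torus_cos (p + u) + B * torus_cos (q + u) = r * torus_cos (u + torus_proj \<phi>)" for u
  proof -
    have "A * torus_cos (p + u) + B * torus_cos (q + u) = X * torus_cos u - Y * torus_sin u"
      unfolding X_def Y_def by (simp add: torus_cos_add algebra_simps)
    then show ?thesis
      by (simp add: r torus_cos_add algebra_simps)
  qed
  then have "(\<integral>u. exp (A * torus_cos (p + u) + B * torus_cos (q + u)) \<partial>torus_uniform)
      = (\<integral>u. exp (r * torus_cos (u + torus_proj \<phi>)) \<partial>torus_uniform)" by simp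
  also have "\<dots> = bessel_I0 r"
    unfolding bessel_I0_eq_integral
    by (rule integral_torus_uniform_shift[where f = "\<lambda>u. exp (r * torus_cos u)"]) simp
  finally show ?thesis using rho by simp
qed

section \<open>A single phase under the tilted weight\<close>

lemma exp_le_one_plus: "0 \<le> y \<Longrightarrow> exp (y - y\<^sup>2) \<le> 1 + (y::real)"
proof (cases "y \<le> 1")
  case True
  assume "0 \<le> y"
  then have "exp (y - y\<^sup>2) \<le> exp (ln (1 + y))"
    using True ln_one_plus_pos_lower_bound[of y] by (simp del: exp_ln)
  then show ?thesis using \<open>0 \<le> y\<close> by simp
next
  case False
  then have "exp (y - y\<^sup>2) \<le> exp 0"
    by (subst exp_le_cancel_iff) (simp add: power2_eq_square)
  also have "exp 0 \<le> 1 + y"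
    using False by simp
  finally show ?thesis .
qed

text \<open>
  The moment of order \<open>h\<close> of one normalised factor. The terms of second order give
  \<open>(h\<^sup>2 - h) a\<^sup>2/4\<close>; for \<open>a = \<alpha>/\<surd>k\<close> the remainder of fourth order is summable over \<open>k\<close>.
\<close>

lemma bessel_I0_tilt_ratio_le:
  assumes h: "0 < h" "h < 1"
  shows "bessel_I0 (h * a) / bessel_I0 a powr h
    \<le> exp (- h * (1 - h) * a\<^sup>2 / 4 + a ^ 4 * (exp (a\<^sup>2 / 2) + 1))"
proof -
  have "bessel_I0 (h * a) \<le> exp ((h * a)\<^sup>2 / 4 + (h * a) ^ 4 * exp ((h * a)\<^sup>2 / 2))"
    by (rule bessel_I0_le)
  also have "\<dots> \<le> exp (h\<^sup>2 * a\<^sup>2 / 4 + a ^ 4 * exp (a\<^sup>2 / 2))"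
  proof -
    have "(h * a)\<^sup>2 \<le> a\<^sup>2" "(h * a) ^ 4 \<le> a ^ 4"
      using h by (simp_all add: power_mult_distrib mult_left_le_one_le power_le_one)
    then have "(h * a) ^ 4 * exp ((h * a)\<^sup>2 / 2) \<le> a ^ 4 * exp (a\<^sup>2 / 2)"
      by (intro mult_mono) auto
    then show ?thesis by (simp add: power_mult_distrib)
  qed
  finally have num: "bessel_I0 (h * a) \<le> exp (h\<^sup>2 * a\<^sup>2 / 4 + a ^ 4 * exp (a\<^sup>2 / 2))" .
  have "exp (a\<^sup>2 / 4 - (a\<^sup>2 / 4)\<^sup>2) \<le> bessel_I0 a"
    using exp_le_one_plus[of "a\<^sup>2 / 4"] bessel_I0_ge[of a] by simp
  then have "exp (a\<^sup>2 / 4 - (a\<^sup>2 / 4)\<^sup>2) powr h \<le> bessel_I0 a powr h"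
    using h by (intro powr_mono2) auto
  moreover have "(a\<^sup>2 / 4)\<^sup>2 * h \<le> a ^ 4"
  proof -
    have "(a\<^sup>2 / 4)\<^sup>2 * h = a ^ 4 * (h / 16)" by (simp add: power_divide)
    also have "\<dots> \<le> a ^ 4 * 1" using h by (intro mult_left_mono) auto
    finally show ?thesis by simp
  qed
  ultimately have den: "exp (h * a\<^sup>2 / 4 - a ^ 4) \<le> bessel_I0 a powr h"
    by (simp add: exp_powr_real algebra_simps) (smt (verit) exp_le_cancel_iff)
  have "bessel_I0 (h * a) / bessel_I0 a powr h
      \<le> exp (h\<^sup>2 * a\<^sup>2 / 4 + a ^ 4 * exp (a\<^sup>2 / 2)) / exp (h * a\<^sup>2 / 4 - a ^ 4)"
    using num den by (intro frac_le) auto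
  also have "\<dots> = exp (- h * (1 - h) * a\<^sup>2 / 4 + a ^ 4 * (exp (a\<^sup>2 / 2) + 1))"
    by (simp add: exp_diff[symmetric] power2_eq_square algebra_simps diff_divide_distrib)
  finally show ?thesis .
qed

text \<open>
  With \<open>f\<close> the normalised factor of one phase, the integrand is \<open>f(p)\<^sup>h (f(q)/f(p))\<close>. Up to a constant it
  is \<open>exp\<close> of a single cosine of squared amplitude \<open>h\<^sup>2a\<^sup>2 + 2(1 - h)a\<^sup>2(1 - c)\<close>, where \<open>c\<close> is the
  cosine of the phase difference. For \<open>p = q\<close> this is the plain moment of order \<open>h\<close>.
\<close>

lemma tilted_phase_le:
  fixes a :: real and p q :: torus
  assumes h: "0 < h" "h < 1"
  defines "c \<equiv> torus_cos p * torus_cos q + torus_sin p * torus_sin q"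
  shows "(\<integral>\<^sup>+u. ennreal ((exp (a * torus_cos (p + u)) / bessel_I0 a) powr (h - 1)
             * (exp (a * torus_cos (q + u)) / bessel_I0 a)) \<partial>torus_uniform)
    \<le> ennreal (exp (- h * (1 - h) * a\<^sup>2 / 4 + a ^ 4 * (exp (a\<^sup>2 / 2) + 1) + a\<^sup>2 * (1 - c)))"
proof -
  have I0: "0 < bessel_I0 a" by (rule bessel_I0_pos)
  have "c \<le> 1"
  proof -
    obtain x y where "p = torus_proj x" "q = torus_proj y" by (metis torus_proj_surj)
    then have "c = cos (x - y)" by (simp add: c_def cos_diff)
    then show ?thesis by simp
  qed
  define \<rho> where "\<rho> = sqrt (a\<^sup>2 * (h\<^sup>2 + 2 * (1 - h) * (1 - c)))"
  have \<rho>2: "\<rho>\<^sup>2 = a\<^sup>2 * (h\<^sup>2 + 2 * (1 - h) * (1 - c))"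
    using h \<open>c \<le> 1\<close> by (simp add: \<rho>_def)
  have diff: "(\<rho>\<^sup>2 - (h * a)\<^sup>2) = a\<^sup>2 * (2 * (1 - h) * (1 - c))"
    by (simp add: \<rho>2 power_mult_distrib algebra_simps)
  have "bessel_I0 \<rho> \<le> bessel_I0 (h * a) * exp ((\<rho>\<^sup>2 - (h * a)\<^sup>2) / 2)"
  proof (rule bessel_I0_ratio_le)
    have "0 \<le> a\<^sup>2 * (2 * (1 - h) * (1 - c))" using h \<open>c \<le> 1\<close> by simp
    then show "(h * a)\<^sup>2 \<le> \<rho>\<^sup>2" unfolding diff[symmetric] by simp
  qed
  also have "(\<rho>\<^sup>2 - (h * a)\<^sup>2) / 2 \<le> a\<^sup>2 * (1 - c)"
  proof -
    have "a\<^sup>2 * ((1 - h) * (1 - c)) \<le> a\<^sup>2 * (1 * (1 - c))"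
      using h \<open>c \<le> 1\<close> by (intro mult_left_mono mult_right_mono) auto
    moreover have "(\<rho>\<^sup>2 - (h * a)\<^sup>2) / 2 = a\<^sup>2 * ((1 - h) * (1 - c))"
      unfolding diff by (simp add: field_simps)
    ultimately show ?thesis by simp
  qed
  finally have \<rho>_le: "bessel_I0 \<rho> \<le> bessel_I0 (h * a) * exp (a\<^sup>2 * (1 - c))"
    using bessel_I0_pos[of "h * a"] by simp
  have *: "(exp (a * torus_cos (p + u)) / bessel_I0 a) powr (h - 1)
             * (exp (a * torus_cos (q + u)) / bessel_I0 a)
      = exp ((h - 1) * a * torus_cos (p + u) + a * torus_cos (q + u)) / bessel_I0 a powr h" for u
  proof -
    have "(exp (a * torus_cos (p + u)) / bessel_I0 a) powr (h - 1)
        = exp ((h - 1) * a * torus_cos (p + u)) / bessel_I0 a powr (h - 1)"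
      using I0 by (simp add: powr_divide exp_powr_real mult_ac)
    moreover have "bessel_I0 a powr h = bessel_I0 a powr (h - 1) * bessel_I0 a"
      using I0 powr_add[of "bessel_I0 a" "h - 1" 1] by simp
    ultimately show ?thesis by (simp add: exp_add)
  qed
  have int: "integrable torus_uniform (\<lambda>u. exp ((h - 1) * a * torus_cos (p + u) + a * torus_cos (q + u)))"
  proof (rule integrable_torus_uniform_bounded)
    fix u
    have "\<bar>(h - 1) * a * torus_cos (p + u) + a * torus_cos (q + u)\<bar> \<le> \<bar>(h - 1) * a\<bar> + \<bar>a\<bar>"
      using abs_mult_torus_cos_le[of "(h - 1) * a" "p + u"] abs_mult_torus_cos_le[of a "q + u"] by linarith
    then show "\<bar>exp ((h - 1) * a * torus_cos (p + u) + a * torus_cos (q + u))\<bar>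
      \<le> exp (\<bar>(h - 1) * a\<bar> + \<bar>a\<bar>)" by simp
  qed (simp add: torus_cos_add)
  have "((h - 1) * a)\<^sup>2 + a\<^sup>2 + 2 * ((h - 1) * a) * a * c = \<rho>\<^sup>2"
    unfolding \<rho>2 by (simp add: power2_eq_square algebra_simps)
  then have val: "(\<integral>u. exp ((h - 1) * a * torus_cos (p + u) + a * torus_cos (q + u)) \<partial>torus_uniform)
      = bessel_I0 \<rho>"
    unfolding c_def by (rule integral_exp_two_cos)
  have "(\<integral>\<^sup>+u. ennreal (exp ((h - 1) * a * torus_cos (p + u) + a * torus_cos (q + u))
      / bessel_I0 a powr h) \<partial>torus_uniform) = ennreal (bessel_I0 \<rho> / bessel_I0 a powr h)"
    using int by (subst nn_integral_eq_integral) (auto simp: val)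
  also have "\<dots> \<le> ennreal (bessel_I0 (h * a) / bessel_I0 a powr h * exp (a\<^sup>2 * (1 - c)))"
    using \<rho>_le I0 by (intro ennreal_leI) (simp add: divide_right_mono)
  also have "\<dots> \<le> ennreal (exp (- h * (1 - h) * a\<^sup>2 / 4 + a ^ 4 * (exp (a\<^sup>2 / 2) + 1)) * exp (a\<^sup>2 * (1 - c)))"
    using bessel_I0_tilt_ratio_le[OF h] by (intro ennreal_leI mult_right_mono) auto
  finally show ?thesis
    unfolding * exp_add[symmetric] .
qed

lemma phase_factor_mean_one:
  "(\<integral>\<^sup>+u. ennreal (exp (a * torus_cos (p + u)) / bessel_I0 a) \<partial>torus_uniform) = 1"
proof -
  have "integrable torus_uniform (\<lambda>u. exp (a * torus_cos (p + u)))"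
  proof (rule integrable_torus_uniform_bounded)
    fix u show "\<bar>exp (a * torus_cos (p + u))\<bar> \<le> exp \<bar>a\<bar>"
      using abs_mult_torus_cos_le[of a "p + u"] by simp
  qed (simp add: torus_cos_add)
  moreover have "(\<integral>u. exp (a * torus_cos (p + u)) \<partial>torus_uniform) = bessel_I0 a"
    using integral_exp_two_cos[of 0 a p p a] by simp
  ultimately show ?thesis
    using bessel_I0_pos[of a] by (subst nn_integral_eq_integral) (auto intro: less_imp_le)
qed

section \<open>Weights, masses and the tangent-line form of concavity\<close>

lemma chaos_weight_pos: "0 < chaos_weight \<alpha> w N t"
  unfolding chaos_weight_def by (intro prod_pos) (auto intro: divide_pos_pos bessel_I0_pos)

lemma chaos_weight_le: "chaos_weight \<alpha> w N t \<le> (\<Prod>n=1..N. exp \<bar>\<alpha> / sqrt (real n)\<bar>)"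
  unfolding chaos_weight_def
proof (intro prod_mono conjI)
  fix n
  have "exp (\<alpha> / sqrt (real n) * torus_cos (torus_multiple n t + w n)) / bessel_I0 (\<alpha> / sqrt (real n))
      \<le> exp (\<alpha> / sqrt (real n) * torus_cos (torus_multiple n t + w n)) / 1"
    using bessel_I0_ge_one by (intro divide_left_mono) (auto intro: bessel_I0_pos)
  also have "\<dots> \<le> exp \<bar>\<alpha> / sqrt (real n)\<bar>"
    unfolding div_by_1 exp_le_cancel_iff
    by (rule order_trans[OF abs_ge_self abs_mult_torus_cos_le])
  finally show "exp (\<alpha> / sqrt (real n) * torus_cos (torus_multiple n t + w n)) / bessel_I0 (\<alpha> / sqrt (real n))
      \<le> exp \<bar>\<alpha> / sqrt (real n)\<bar>" .
qed (auto intro: divide_nonneg_nonneg less_imp_le[OF bessel_I0_pos])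

lemma chaos_weight_0 [simp]: "chaos_weight \<alpha> w 0 t = 1"
  by (simp add: chaos_weight_def)

lemma chaos_weight_Suc:
  "chaos_weight \<alpha> w (Suc N) t = chaos_weight \<alpha> w N t *
     (exp (\<alpha> / sqrt (real (Suc N)) * torus_cos (torus_multiple (Suc N) t + w (Suc N)))
        / bessel_I0 (\<alpha> / sqrt (real (Suc N))))"
  by (simp add: chaos_weight_def)

lemma chaos_weight_cong:
  "(\<And>n. n \<in> {1..N} \<Longrightarrow> w n = w' n) \<Longrightarrow> chaos_weight \<alpha> w N t = chaos_weight \<alpha> w' N t"
  unfolding chaos_weight_def by (intro prod.cong) auto

lemma measurable_chaos_weight:
  assumes "\<And>n. n \<in> {1..N} \<Longrightarrow> (\<lambda>z. w z n) \<in> borel_measurable K"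
    and "\<tau> \<in> borel_measurable K"
  shows "(\<lambda>z. chaos_weight \<alpha> (w z) N (\<tau> z)) \<in> borel_measurable K"
  unfolding chaos_weight_def torus_cos_add
proof (intro borel_measurable_prod)
  fix n assume "n \<in> {1..N}"
  note [measurable] = assms(1)[OF this] assms(2)
  show "(\<lambda>z. exp (\<alpha> / sqrt (real n) * (torus_cos (torus_multiple n (\<tau> z)) * torus_cos (w z n)
      - torus_sin (torus_multiple n (\<tau> z)) * torus_sin (w z n))) / bessel_I0 (\<alpha> / sqrt (real n)))
    \<in> borel_measurable K"
    by measurable
qed

definition chaos_mass :: "real \<Rightarrow> torus measure \<Rightarrow> torus set \<Rightarrow> (nat \<Rightarrow> torus) \<Rightarrow> nat \<Rightarrow> real" where
  "chaos_mass \<alpha> \<sigma> B w N = (\<integral>t. chaos_weight \<alpha> w N t * indicator B t \<partial>\<sigma>)"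

lemma chaos_mass_nonneg: "0 \<le> chaos_mass \<alpha> \<sigma> B w N"
  unfolding chaos_mass_def
  by (intro integral_nonneg_AE always_eventually) (simp add: less_imp_le[OF chaos_weight_pos])

lemma chaos_mass_cong:
  "(\<And>n. n \<in> {1..N} \<Longrightarrow> w n = w' n) \<Longrightarrow> chaos_mass \<alpha> \<sigma> B w N = chaos_mass \<alpha> \<sigma> B w' N"
  unfolding chaos_mass_def using chaos_weight_cong[of N w w'] by simp

lemma measurable_chaos_mass:
  assumes fin: "finite_measure \<sigma>" and sets: "sets \<sigma> = sets borel" and B: "B \<in> sets borel"
    and w: "\<And>n. n \<in> {1..N} \<Longrightarrow> (\<lambda>z. w z n) \<in> borel_measurable K"
  shows "(\<lambda>z. chaos_mass \<alpha> \<sigma> B (w z) N) \<in> borel_measurable K"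
  unfolding chaos_mass_def
proof (rule sigma_finite_measure.borel_measurable_lebesgue_integral)
  show "sigma_finite_measure \<sigma>"
    using fin by (rule finite_measure.axioms)
  note [measurable_cong] = sets and [measurable] = B
  have "(\<lambda>p. chaos_weight \<alpha> (w (fst p)) N (snd p)) \<in> borel_measurable (K \<Otimes>\<^sub>M \<sigma>)"
    by (rule measurable_chaos_weight)
       (use w sets in \<open>auto intro: measurable_compose[OF measurable_fst]
          simp: measurable_cong_sets[OF refl sets[symmetric]]\<close>)
  then show "(\<lambda>(z, t). chaos_weight \<alpha> (w z) N t * indicator B t) \<in> borel_measurable (K \<Otimes>\<^sub>M \<sigma>)"
    unfolding split_beta by measurable
qed

lemma integrable_chaos_weight:
  assumes fin: "finite_measure \<sigma>" and sets: "sets \<sigma> = sets borel" and B: "B \<in> sets borel"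
  shows "integrable \<sigma> (\<lambda>t. chaos_weight \<alpha> w N t * indicator B t)"
proof (rule finite_measure.integrable_const_bound[OF fin])
  show "AE t in \<sigma>. norm (chaos_weight \<alpha> w N t * indicator B t) \<le> (\<Prod>n=1..N. exp \<bar>\<alpha> / sqrt (real n)\<bar>)"
    using chaos_weight_le chaos_weight_pos
    by (intro always_eventually) (auto simp: indicator_def less_imp_le prod_nonneg)
  note [measurable_cong] = sets and [measurable] = B
  have [measurable]: "chaos_weight \<alpha> w N \<in> borel_measurable \<sigma>"
    using measurable_chaos_weight[of N "\<lambda>_. w" \<sigma> "\<lambda>t. t" \<alpha>] measurable_ident_sets[OF sets] by simp
  show "(\<lambda>t. chaos_weight \<alpha> w N t * indicator B t) \<in> borel_measurable \<sigma>"
    by measurable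
qed

lemma ennreal_chaos_mass:
  assumes "finite_measure \<sigma>" "sets \<sigma> = sets borel" "B \<in> sets borel"
  shows "ennreal (chaos_mass \<alpha> \<sigma> B w N) = (\<integral>\<^sup>+t. ennreal (chaos_weight \<alpha> w N t) * indicator B t \<partial>\<sigma>)"
  unfolding chaos_mass_def
  by (subst nn_integral_eq_integral[OF integrable_chaos_weight[OF assms], symmetric])
     (auto simp: less_imp_le[OF chaos_weight_pos] indicator_def intro!: nn_integral_cong)

text \<open>
  The graph of the concave function \<open>y \<mapsto> y\<^sup>h\<close> lies below its tangent at \<open>c\<close>. Both Jensen's
  inequality below and the estimate on small balls come from this with a suitable, possibly random,
  point \<open>c\<close>.
\<close>

lemma powr_le_tangent:
  fixes y c h :: real
  assumes "0 < h" "h < 1" "0 \<le> y" "0 < c"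
  shows "y powr h \<le> (1 - h) * c powr h + h * (c powr (h - 1) * y)"
proof (cases "y = 0")
  case True
  then show ?thesis using assms by simp
next
  case False
  then have "(y / c) powr h * 1 powr (1 - h) \<le> h * (y / c) + (1 - h) * 1"
    using assms by (intro Youngs_inequality_0) auto
  then have "c powr h * (y / c) powr h \<le> c powr h * (h * (y / c) + (1 - h))"
    by (intro mult_left_mono) auto
  also have "\<dots> = (1 - h) * c powr h + h * (c powr h / c * y)"
    by (simp add: algebra_simps)
  also have "c powr h / c = c powr (h - 1)"
    using assms by (simp add: powr_diff)
  also have "c powr h * (y / c) powr h = y powr h"
    using assms by (simp add: powr_divide)
  finally show ?thesis .
qed

lemma (in prob_space) nn_integral_powr_le:
  fixes f :: "'a \<Rightarrow> real"
  assumes [measurable]: "f \<in> borel_measurable M" and nonneg: "\<And>x. 0 \<le> f x"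
    and h: "0 < h" "h < 1" and c: "0 \<le> c" and le: "(\<integral>\<^sup>+x. ennreal (f x) \<partial>M) \<le> ennreal c"
  shows "(\<integral>\<^sup>+x. ennreal (f x powr h) \<partial>M) \<le> ennreal (c powr h)"
proof (cases "c = 0")
  case True
  then have "(\<integral>\<^sup>+x. ennreal (f x) \<partial>M) = 0" using le by simp
  then have "AE x in M. ennreal (f x) = 0"
    by (subst (asm) nn_integral_0_iff_AE) auto
  then have "AE x in M. ennreal (f x powr h) = 0"
    by eventually_elim (use nonneg in \<open>simp add: antisym\<close>)
  then have "(\<integral>\<^sup>+x. ennreal (f x powr h) \<partial>M) = (\<integral>\<^sup>+x. 0 \<partial>M)"
    by (rule nn_integral_cong_AE)
  then show ?thesis by simp
next
  case False
  with c have c: "0 < c" by simp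
  have "(\<integral>\<^sup>+x. ennreal (f x powr h) \<partial>M)
      \<le> (\<integral>\<^sup>+x. ennreal ((1 - h) * c powr h) + ennreal (h * c powr (h - 1)) * ennreal (f x) \<partial>M)"
  proof (rule nn_integral_mono)
    fix x
    have "ennreal (f x powr h) \<le> ennreal ((1 - h) * c powr h + h * (c powr (h - 1) * f x))"
      by (intro ennreal_leI powr_le_tangent h nonneg c)
    also have "\<dots> = ennreal ((1 - h) * c powr h) + ennreal (h * c powr (h - 1)) * ennreal (f x)"
      using h nonneg[of x] by (simp add: ennreal_mult ennreal_plus mult.assoc)
    finally show "ennreal (f x powr h)
      \<le> ennreal ((1 - h) * c powr h) + ennreal (h * c powr (h - 1)) * ennreal (f x)" .
  qed
  also have "\<dots> = ennreal ((1 - h) * c powr h) + ennreal (h * c powr (h - 1)) * (\<integral>\<^sup>+x. ennreal (f x) \<partial>M)"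
    by (subst nn_integral_add) (auto simp: nn_integral_cmult emeasure_space_1)
  also have "\<dots> \<le> ennreal ((1 - h) * c powr h) + ennreal (h * c powr (h - 1)) * ennreal c"
    by (intro add_left_mono mult_left_mono le) auto
  also have "\<dots> = ennreal ((1 - h) * c powr h + h * (c powr (h - 1) * c))"
    using h c by (simp add: ennreal_mult ennreal_plus mult.assoc)
  also have "c powr (h - 1) * c = c powr h"
    using c by (simp add: powr_diff)
  also have "(1 - h) * c powr h + h * c powr h = c powr h"
    by (simp add: algebra_simps)
  finally show ?thesis .
qed

section \<open>Supermartingale property of fractional powers of the mass\<close>

locale random_phases = prob_space M for M :: "'b measure" +
  fixes \<omega> :: "nat \<Rightarrow> 'b \<Rightarrow> torus"
  assumes indep: "indep_vars (\<lambda>_. borel) \<omega> {1..}"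
    and uniform: "\<And>n. n \<ge> 1 \<Longrightarrow> distr M borel (\<omega> n) = torus_uniform"
begin

lemma measurable_phase [measurable]: "n \<ge> 1 \<Longrightarrow> \<omega> n \<in> borel_measurable M"
  using indep by (auto simp: indep_vars_def)

lemma distr_phases:
  assumes "I \<noteq> {}" "I \<subseteq> {1..}"
  shows "distr M (PiM I (\<lambda>_. borel)) (\<lambda>x. \<lambda>i\<in>I. \<omega> i x) = PiM I (\<lambda>_. torus_uniform)"
proof -
  have "distr M (PiM I (\<lambda>_. borel)) (\<lambda>x. \<lambda>i\<in>I. \<omega> i x) = PiM I (\<lambda>i. distr M borel (\<omega> i))"
    using assms indep_vars_subset[OF indep assms(2)]
    by (subst indep_vars_iff_distr_eq_PiM'[symmetric]) (auto intro: measurable_phase)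
  also have "\<dots> = PiM I (\<lambda>_. torus_uniform)"
    using assms by (intro PiM_cong) (auto simp: uniform)
  finally show ?thesis .
qed

text \<open>
  Replacing one phase by a fresh uniform variable does not change the joint law. In this form,
  conditional expectation given the other phases is an ordinary inner integral.
\<close>

lemma nn_integral_resample_phase:
  fixes F :: "(nat \<Rightarrow> torus) \<Rightarrow> ennreal"
  assumes I: "finite I" "I \<subseteq> {1..}" "k \<in> I"
    and F: "F \<in> borel_measurable (PiM I (\<lambda>_. borel))"
  shows "(\<integral>\<^sup>+x. F (\<lambda>i\<in>I. \<omega> i x) \<partial>M)
       = (\<integral>\<^sup>+x. (\<integral>\<^sup>+u. F ((\<lambda>i\<in>I. \<omega> i x)(k := u)) \<partial>torus_uniform) \<partial>M)"
proof -
  interpret product_sigma_finite "\<lambda>_::nat. torus_uniform" ..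
  define J where "J = I - {k}"
  have J: "I = insert k J" "finite J" "k \<notin> J"
    using I by (auto simp: J_def)
  have sets: "sets (PiM I (\<lambda>_. torus_uniform)) = sets (PiM I (\<lambda>_. borel))"
    by (intro sets_PiM_cong) auto
  have FT [measurable]: "F \<in> borel_measurable (PiM I (\<lambda>_. torus_uniform))"
    using F by (simp add: measurable_cong_sets[OF sets refl])
  have [measurable]: "(\<lambda>p. (fst p)(k := snd p)) \<in> PiM I (\<lambda>_. torus_uniform) \<Otimes>\<^sub>M torus_uniform
      \<rightarrow>\<^sub>M PiM I (\<lambda>_. torus_uniform)"
    using I by (intro measurable_fun_upd[where J = I]) auto
  define G where "G w = (\<integral>\<^sup>+u. F (w(k := u)) \<partial>torus_uniform)" for w
  have GT [measurable]: "G \<in> borel_measurable (PiM I (\<lambda>_. torus_uniform))"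
  proof -
    have "(\<lambda>p. F ((fst p)(k := snd p))) \<in> borel_measurable (PiM I (\<lambda>_. torus_uniform) \<Otimes>\<^sub>M torus_uniform)"
      by measurable
    then show ?thesis
      unfolding G_def by (intro torus_uniform.borel_measurable_nn_integral) (simp add: split_beta)
  qed
  have transport: "(\<integral>\<^sup>+x. H (\<lambda>i\<in>I. \<omega> i x) \<partial>M) = (\<integral>\<^sup>+w. H w \<partial>PiM I (\<lambda>_. torus_uniform))"
    if "H \<in> borel_measurable (PiM I (\<lambda>_. torus_uniform))" for H
  proof -
    have [measurable]: "(\<lambda>x. \<lambda>i\<in>I. \<omega> i x) \<in> M \<rightarrow>\<^sub>M PiM I (\<lambda>_. borel)"
      using I by (intro measurable_restrict measurable_phase) auto
    show ?thesis
      using I that by (subst distr_phases[symmetric], use I in auto, subst nn_integral_distr)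
        (auto simp: measurable_cong_sets[OF sets refl])
  qed
  have split: "(\<integral>\<^sup>+w. H w \<partial>PiM I (\<lambda>_. torus_uniform))
      = (\<integral>\<^sup>+w. (\<integral>\<^sup>+u. H (w(k := u)) \<partial>torus_uniform) \<partial>PiM J (\<lambda>_. torus_uniform))"
    if "H \<in> borel_measurable (PiM I (\<lambda>_. torus_uniform))" for H
    using that J by (simp add: product_nn_integral_insert)
  have "(\<integral>\<^sup>+w. F w \<partial>PiM I (\<lambda>_. torus_uniform)) = (\<integral>\<^sup>+w. G w \<partial>PiM I (\<lambda>_. torus_uniform))"
    unfolding split[OF FT] split[OF GT]
    by (simp add: G_def torus_uniform.emeasure_space_1[simplified])
  then show ?thesis
    by (simp add: transport[OF FT] transport[OF GT, unfolded G_def] G_def)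
qed

end

text \<open>
  The factor with index \<open>Suc N\<close> has mean \<open>1\<close> at every point, so by Fubini's theorem averaging over
  the last phase returns the previous mass: the mass is a martingale.
\<close>

lemma chaos_mass_step:
  assumes fin: "finite_measure \<sigma>" and sets: "sets \<sigma> = sets borel" and B: "B \<in> sets borel"
  shows "(\<integral>\<^sup>+u. ennreal (chaos_mass \<alpha> \<sigma> B (w(Suc N := u)) (Suc N)) \<partial>torus_uniform)
    = ennreal (chaos_mass \<alpha> \<sigma> B w N)"
proof -
  interpret \<sigma>: finite_measure \<sigma> by fact
  interpret pair_sigma_finite torus_uniform \<sigma> ..
  note [measurable_cong] = sets and [measurable] = B
  have meas: "(\<lambda>p. chaos_weight \<alpha> (w(Suc N := fst p)) (Suc N) (snd p))
      \<in> borel_measurable (torus_uniform \<Otimes>\<^sub>M \<sigma>)"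
  proof (rule measurable_chaos_weight)
    show "(\<lambda>p. (w(Suc N := fst p)) n) \<in> borel_measurable (torus_uniform \<Otimes>\<^sub>M \<sigma>)" for n
      unfolding fun_upd_def by measurable
    show "snd \<in> borel_measurable (torus_uniform \<Otimes>\<^sub>M \<sigma>)"
      by measurable
  qed
  have fac: "(\<integral>\<^sup>+u. ennreal (chaos_weight \<alpha> (w(Suc N := u)) (Suc N) t) * indicator B t \<partial>torus_uniform)
      = ennreal (chaos_weight \<alpha> w N t) * indicator B t" for t
  proof -
    let ?a = "\<alpha> / sqrt (real (Suc N))" and ?p = "torus_multiple (Suc N) t"
    have "ennreal (chaos_weight \<alpha> (w(Suc N := u)) (Suc N) t) * indicator B t
        = ennreal (chaos_weight \<alpha> w N t) * indicator B t
          * ennreal (exp (?a * torus_cos (?p + u)) / bessel_I0 ?a)" for u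
    proof -
      have "chaos_weight \<alpha> (w(Suc N := u)) N t = chaos_weight \<alpha> w N t"
        by (rule chaos_weight_cong) auto
      then have "chaos_weight \<alpha> (w(Suc N := u)) (Suc N) t
          = chaos_weight \<alpha> w N t * (exp (?a * torus_cos (?p + u)) / bessel_I0 ?a)"
        by (simp only: chaos_weight_Suc fun_upd_same)
      then have "ennreal (chaos_weight \<alpha> (w(Suc N := u)) (Suc N) t)
          = ennreal (chaos_weight \<alpha> w N t) * ennreal (exp (?a * torus_cos (?p + u)) / bessel_I0 ?a)"
        using chaos_weight_pos[of \<alpha> w N t] bessel_I0_pos[of ?a]
        by (simp only: ennreal_mult less_imp_le divide_nonneg_pos exp_ge_zero)
      then show ?thesis by (simp only: mult.assoc mult.commute mult.left_commute)
    qed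
    then show ?thesis
      using phase_factor_mean_one[of ?a ?p]
      by (simp add: nn_integral_cmult torus_cos_add del: of_nat_Suc)
  qed
  have "(\<integral>\<^sup>+u. ennreal (chaos_mass \<alpha> \<sigma> B (w(Suc N := u)) (Suc N)) \<partial>torus_uniform)
    = (\<integral>\<^sup>+u. \<integral>\<^sup>+t. ennreal (chaos_weight \<alpha> (w(Suc N := u)) (Suc N) t) * indicator B t \<partial>\<sigma> \<partial>torus_uniform)"
    by (simp add: ennreal_chaos_mass[OF fin sets B])
  also have "\<dots> = (\<integral>\<^sup>+t. \<integral>\<^sup>+u. ennreal (chaos_weight \<alpha> (w(Suc N := u)) (Suc N) t) * indicator B t \<partial>torus_uniform \<partial>\<sigma>)"
    using meas by (intro Fubini'[symmetric]) (simp add: split_beta)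
  also have "\<dots> = ennreal (chaos_mass \<alpha> \<sigma> B w N)"
    by (simp add: fac ennreal_chaos_mass[OF fin sets B])
  finally show ?thesis .
qed

context random_phases begin

lemma measurable_chaos_mass_phases:
  assumes "finite_measure \<sigma>" "sets \<sigma> = sets borel" "B \<in> sets borel"
  shows "(\<lambda>x. chaos_mass \<alpha> \<sigma> B (\<lambda>n. \<omega> n x) N) \<in> borel_measurable M"
  using assms by (rule measurable_chaos_mass) (auto intro: measurable_phase)

text \<open>
  Jensen's inequality for the concave power, applied to the last phase only. The factor \<open>g\<close>, which
  depends on the first \<open>N\<close> phases, plays the part of an event in the past.
\<close>

lemma chaos_mass_powr_supermartingale:
  fixes g :: "(nat \<Rightarrow> torus) \<Rightarrow> ennreal"
  assumes \<sigma>: "finite_measure \<sigma>" "sets \<sigma> = sets borel" "B \<in> sets borel"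
    and h: "0 < h" "h < 1"
    and g: "g \<in> borel_measurable (PiM {1..Suc N} (\<lambda>_. borel))"
      "\<And>w w'. (\<And>n. n \<in> {1..N} \<Longrightarrow> w n = w' n) \<Longrightarrow> g w = g w'"
  shows "(\<integral>\<^sup>+x. g (\<lambda>n. \<omega> n x) * ennreal (chaos_mass \<alpha> \<sigma> B (\<lambda>n. \<omega> n x) (Suc N) powr h) \<partial>M)
      \<le> (\<integral>\<^sup>+x. g (\<lambda>n. \<omega> n x) * ennreal (chaos_mass \<alpha> \<sigma> B (\<lambda>n. \<omega> n x) N powr h) \<partial>M)"
proof -
  let ?Y = "\<lambda>w N. chaos_mass \<alpha> \<sigma> B w N"
  let ?I = "{1..Suc N}"
  note [measurable] = g(1)
  have [measurable]: "(\<lambda>w. ?Y w (Suc N)) \<in> borel_measurable (PiM ?I (\<lambda>_. borel))"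
    by (rule measurable_chaos_mass[OF \<sigma>]) (rule measurable_component_singleton)
  have rest: "g (\<lambda>n. \<omega> n x) * ennreal (?Y (\<lambda>n. \<omega> n x) (Suc N) powr h)
      = g (\<lambda>n\<in>?I. \<omega> n x) * ennreal (?Y (\<lambda>n\<in>?I. \<omega> n x) (Suc N) powr h)" for x
  proof -
    have "g (\<lambda>n. \<omega> n x) = g (\<lambda>n\<in>?I. \<omega> n x)" by (rule g(2)) auto
    moreover have "?Y (\<lambda>n. \<omega> n x) (Suc N) = ?Y (\<lambda>n\<in>?I. \<omega> n x) (Suc N)"
      by (rule chaos_mass_cong) auto
    ultimately show ?thesis by simp
  qed
  have "(\<integral>\<^sup>+x. g (\<lambda>n. \<omega> n x) * ennreal (?Y (\<lambda>n. \<omega> n x) (Suc N) powr h) \<partial>M)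
      = (\<integral>\<^sup>+x. (\<integral>\<^sup>+u. g ((\<lambda>n\<in>?I. \<omega> n x)(Suc N := u))
          * ennreal (?Y ((\<lambda>n\<in>?I. \<omega> n x)(Suc N := u)) (Suc N) powr h) \<partial>torus_uniform) \<partial>M)"
    unfolding rest by (rule nn_integral_resample_phase[where k = "Suc N"]) (simp, simp, simp, measurable)
  also have "\<dots> \<le> (\<integral>\<^sup>+x. g (\<lambda>n. \<omega> n x) * ennreal (?Y (\<lambda>n. \<omega> n x) N powr h) \<partial>M)"
  proof (rule nn_integral_mono)
    fix x
    let ?w = "\<lambda>n\<in>?I. \<omega> n x"
    have gw: "g (?w(Suc N := u)) = g (\<lambda>n. \<omega> n x)" for u by (rule g(2)) auto
    have Yw: "?Y ?w N = ?Y (\<lambda>n. \<omega> n x) N" by (rule chaos_mass_cong) auto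
    have meas [measurable]: "(\<lambda>u. ?Y (?w(Suc N := u)) (Suc N)) \<in> borel_measurable torus_uniform"
      by (rule measurable_chaos_mass[OF \<sigma>]) (simp add: fun_upd_def)
    have "(\<integral>\<^sup>+u. ennreal (?Y (?w(Suc N := u)) (Suc N) powr h) \<partial>torus_uniform) \<le> ennreal (?Y ?w N powr h)"
      using meas by (intro torus_uniform.nn_integral_powr_le h chaos_mass_nonneg)
        (simp_all add: chaos_mass_step[OF \<sigma>])
    moreover have "(\<lambda>u. ennreal (?Y (?w(Suc N := u)) (Suc N) powr h)) \<in> borel_measurable torus_uniform"
      using meas by measurable
    ultimately show "(\<integral>\<^sup>+u. g (?w(Suc N := u)) * ennreal (?Y (?w(Suc N := u)) (Suc N) powr h) \<partial>torus_uniform)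
      \<le> g (\<lambda>n. \<omega> n x) * ennreal (?Y (\<lambda>n. \<omega> n x) N powr h)"
      unfolding gw Yw by (subst nn_integral_cmult) (assumption, rule mult_left_mono, assumption, simp)
  qed
  finally show ?thesis .
qed

lemma chaos_mass_powr_decreasing:
  assumes \<sigma>: "finite_measure \<sigma>" "sets \<sigma> = sets borel" "B \<in> sets borel"
    and h: "0 < h" "h < 1" and "m \<le> N"
  shows "(\<integral>\<^sup>+x. ennreal (chaos_mass \<alpha> \<sigma> B (\<lambda>n. \<omega> n x) N powr h) \<partial>M)
      \<le> (\<integral>\<^sup>+x. ennreal (chaos_mass \<alpha> \<sigma> B (\<lambda>n. \<omega> n x) m powr h) \<partial>M)"
  using \<open>m \<le> N\<close>
proof (induction N rule: dec_induct)
  case (step N)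
  show ?case
    using chaos_mass_powr_supermartingale[OF \<sigma> h, of "\<lambda>_. 1" N \<alpha>] step.IH by simp
qed simp

text \<open>
  Doob's maximal inequality: up to the first time at which the level \<open>c\<close> is reached, the
  supermartingale keeps at most its initial mean, and at that time it is worth at least \<open>c\<close>.
\<close>

lemma chaos_mass_maximal_inequality:
  assumes \<sigma>: "finite_measure \<sigma>" "sets \<sigma> = sets borel" "B \<in> sets borel"
    and h: "0 < h" "h < 1" and c: "0 \<le> c" and "m \<le> N"
  shows "ennreal c * emeasure M {x \<in> space M. \<exists>k\<in>{m..N}. c \<le> chaos_mass \<alpha> \<sigma> B (\<lambda>n. \<omega> n x) k powr h}
      \<le> (\<integral>\<^sup>+x. ennreal (chaos_mass \<alpha> \<sigma> B (\<lambda>n. \<omega> n x) m powr h) \<partial>M)"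
proof -
  define Z where "Z k w = chaos_mass \<alpha> \<sigma> B w k powr h" for k w
  define W where "W = (\<lambda>x n. \<omega> n x)"
  \<comment> \<open>\<open>G N\<close> is the event that the level \<open>c\<close> has not been reached by time \<open>N\<close>; it depends on the first \<open>N\<close> phases.\<close>
  define G where "G N w = (\<forall>k\<in>{m..N}. Z k w < c)" for N and w :: "nat \<Rightarrow> torus"
  have Zm: "Z k \<in> borel_measurable (PiM {1..N} (\<lambda>_. borel))" if "k \<le> N" for k N
  proof -
    have [measurable]: "(\<lambda>w. chaos_mass \<alpha> \<sigma> B w k) \<in> borel_measurable (PiM {1..N} (\<lambda>_. borel))"
      by (rule measurable_chaos_mass[OF \<sigma>]) (use that in \<open>auto intro: measurable_component_singleton\<close>)
    show ?thesis unfolding Z_def by measurable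
  qed
  have [measurable]: "(\<lambda>x. Z k (W x)) \<in> borel_measurable M" for k
    unfolding Z_def W_def using measurable_chaos_mass_phases[OF \<sigma>] by measurable
  have [measurable]: "Measurable.pred M (\<lambda>x. G k (W x))" for k
    unfolding G_def by measurable
  have "(\<integral>\<^sup>+x. ennreal c * indicator {x. \<not> G N (W x)} x + indicator {w. G N w} (W x) * ennreal (Z N (W x)) \<partial>M)
      \<le> (\<integral>\<^sup>+x. ennreal (Z m (W x)) \<partial>M)"
    using \<open>m \<le> N\<close>
  proof (induction N rule: dec_induct)
    case base
    show ?case
      by (intro nn_integral_mono) (auto simp: indicator_def G_def not_less intro: ennreal_leI)
  next
    case (step N)
    have "(\<integral>\<^sup>+x. ennreal c * indicator {x. \<not> G (Suc N) (W x)} x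
          + indicator {w. G (Suc N) w} (W x) * ennreal (Z (Suc N) (W x)) \<partial>M)
        \<le> (\<integral>\<^sup>+x. ennreal c * indicator {x. \<not> G N (W x)} x
          + indicator {w. G N w} (W x) * ennreal (Z (Suc N) (W x)) \<partial>M)"
    proof (rule nn_integral_mono)
      fix x
      have "G (Suc N) (W x) \<longleftrightarrow> G N (W x) \<and> Z (Suc N) (W x) < c"
        using step.hyps by (auto simp: G_def le_Suc_eq)
      then show "ennreal c * indicator {x. \<not> G (Suc N) (W x)} x
          + indicator {w. G (Suc N) w} (W x) * ennreal (Z (Suc N) (W x))
        \<le> ennreal c * indicator {x. \<not> G N (W x)} x
          + indicator {w. G N w} (W x) * ennreal (Z (Suc N) (W x))"
        by (auto simp: indicator_def not_less intro: ennreal_leI)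
    qed
    also have "\<dots> = (\<integral>\<^sup>+x. ennreal c * indicator {x. \<not> G N (W x)} x \<partial>M)
        + (\<integral>\<^sup>+x. indicator {w. G N w} (W x) * ennreal (Z (Suc N) (W x)) \<partial>M)"
      by (rule nn_integral_add) (auto simp: indicator_def)
    also have "\<dots> \<le> (\<integral>\<^sup>+x. ennreal c * indicator {x. \<not> G N (W x)} x \<partial>M)
        + (\<integral>\<^sup>+x. indicator {w. G N w} (W x) * ennreal (Z N (W x)) \<partial>M)"
    proof (rule add_left_mono)
      have [measurable]: "Measurable.pred (PiM {1..Suc N} (\<lambda>_. borel)) (\<lambda>w. Z k w < c)" if "k \<in> {m..N}" for k
        proof -
          have [measurable]: "Z k \<in> borel_measurable (PiM {1..Suc N} (\<lambda>_. borel))"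
            using that by (intro Zm) simp
          show ?thesis by measurable
        qed
      have "(\<lambda>w. indicator {w. G N w} w :: ennreal) \<in> borel_measurable (PiM {1..Suc N} (\<lambda>_. borel))"
        unfolding G_def indicator_def mem_Collect_eq by measurable
      moreover have "indicator {w. G N w} w = (indicator {w. G N w} w' :: ennreal)"
        if "\<And>n. n \<in> {1..N} \<Longrightarrow> w n = w' n" for w w'
      proof -
        have "Z k w = Z k w'" if "k \<le> N" for k
          unfolding Z_def using that \<open>\<And>n. n \<in> {1..N} \<Longrightarrow> w n = w' n\<close>
          by (subst chaos_mass_cong[of k w w']) auto
        then show ?thesis by (auto simp: G_def indicator_def)
      qed
      ultimately show "(\<integral>\<^sup>+x. indicator {w. G N w} (W x) * ennreal (Z (Suc N) (W x)) \<partial>M)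
          \<le> (\<integral>\<^sup>+x. indicator {w. G N w} (W x) * ennreal (Z N (W x)) \<partial>M)"
        unfolding Z_def W_def by (rule chaos_mass_powr_supermartingale[OF \<sigma> h])
    qed
    also have "\<dots> = (\<integral>\<^sup>+x. ennreal c * indicator {x. \<not> G N (W x)} x
        + indicator {w. G N w} (W x) * ennreal (Z N (W x)) \<partial>M)"
      by (rule nn_integral_add[symmetric]) (auto simp: indicator_def)
    finally show ?case using step.IH by (rule order_trans)
  qed
  moreover have "ennreal c * emeasure M {x \<in> space M. \<not> G N (W x)}
      = (\<integral>\<^sup>+x. ennreal c * indicator {x \<in> space M. \<not> G N (W x)} x \<partial>M)"
    by (subst nn_integral_cmult_indicator) auto
  moreover have "\<dots> \<le> (\<integral>\<^sup>+x. ennreal c * indicator {x. \<not> G N (W x)} x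
      + indicator {w. G N w} (W x) * ennreal (Z N (W x)) \<partial>M)"
    by (intro nn_integral_mono) (auto simp: indicator_def)
  moreover have "{x \<in> space M. \<not> G N (W x)}
      = {x \<in> space M. \<exists>k\<in>{m..N}. c \<le> chaos_mass \<alpha> \<sigma> B (\<lambda>n. \<omega> n x) k powr h}"
    by (auto simp: G_def Z_def W_def not_less)
  ultimately show ?thesis
    by (simp add: Z_def W_def)
qed

end

section \<open>Fractional moments on small balls, and almost sure convergence\<close>

context random_phases begin

lemma nn_integral_phase:
  fixes f :: "torus \<Rightarrow> ennreal"
  assumes "k \<ge> 1" "f \<in> borel_measurable borel"
  shows "(\<integral>\<^sup>+x. f (\<omega> k x) \<partial>M) = (\<integral>\<^sup>+u. f u \<partial>torus_uniform)"
  using assms by (subst uniform[OF assms(1), symmetric], subst nn_integral_distr) (auto intro: measurable_phase)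

end

text \<open>
  The product over all \<open>k\<close> of the fourth-order errors and of the costs of moving within the ball;
  \<open>2\<close> bounds the sum of the inverse squares.
\<close>

definition small_ball_const :: "real \<Rightarrow> real" where
  "small_ball_const \<alpha> = exp (2 * (\<alpha> ^ 4 * (exp (\<alpha>\<^sup>2 / 2) + 1)) + \<alpha>\<^sup>2 / 2)"

lemma sum_inverse_squares_le: "(\<Sum>k=1..n. 1 / (real k)\<^sup>2) \<le> 2"
proof -
  have "(\<Sum>k=1..n. 1 / (real k)\<^sup>2) \<le> 2 - 1 / real n" if "n \<ge> 1" for n
    using that
  proof (induction n rule: dec_induct)
    case (step n)
    have "1 / (real (Suc n))\<^sup>2 \<le> 1 / (real n * real (Suc n))"
      unfolding power2_eq_square using step.hyps by (intro divide_left_mono mult_right_mono) auto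
    also have "\<dots> = 1 / real n - 1 / real (Suc n)"
      using step.hyps by (simp add: field_simps)
    finally have "1 / (real (Suc n))\<^sup>2 \<le> 1 / real n - 1 / real (Suc n)" .
    then show ?case using step by simp
  qed simp
  from this[of n] show ?thesis
    by (cases "n \<ge> 1") (auto intro: order_trans)
qed

text \<open>
  The three groups of terms are the logarithmic decay, a convergent remainder, and the cost of
  moving by \<open>1/n\<close>, which accumulates to a bounded total just because only \<open>k \<le> n\<close> takes part.
\<close>

lemma sum_phase_exponents_le:
  assumes n: "n \<ge> 1" and \<beta>: "0 \<le> \<beta>"
  shows "exp (\<Sum>k=1..n. - \<beta> / real k + \<alpha> ^ 4 * (exp (\<alpha>\<^sup>2 / 2) + 1) / (real k)\<^sup>2
           + \<alpha>\<^sup>2 * real k / (2 * (real n)\<^sup>2))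
       \<le> small_ball_const \<alpha> * real n powr (- \<beta>)"
proof -
  let ?E = "\<alpha> ^ 4 * (exp (\<alpha>\<^sup>2 / 2) + 1)"
  have "ln (real n) \<le> ln (real n + 1)" using n by simp
  also have "\<dots> \<le> (\<Sum>k=1..n. 1 / real k)"
    using ln_le_harm[of n] by (simp add: harm_def inverse_eq_divide)
  finally have 1: "(\<Sum>k=1..n. - \<beta> / real k) \<le> - \<beta> * ln (real n)"
    using \<beta> by (simp add: sum_negf sum_divide_distrib[symmetric] mult_left_mono flip: sum_distrib_left)
       (use mult_left_mono[of "ln (real n)" "\<Sum>k=1..n. 1 / real k" \<beta>] in \<open>simp add: sum_distrib_left\<close>)
  have "(\<Sum>k=1..n. ?E / (real k)\<^sup>2) = ?E * (\<Sum>k=1..n. 1 / (real k)\<^sup>2)"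
    by (simp add: sum_distrib_left)
  also have "\<dots> \<le> ?E * 2"
    using sum_inverse_squares_le[of n] by (intro mult_left_mono) (auto simp: add_nonneg_nonneg)
  finally have 2: "(\<Sum>k=1..n. ?E / (real k)\<^sup>2) \<le> 2 * ?E" by simp
  have "(\<Sum>k=1..n. \<alpha>\<^sup>2 * real k / (2 * (real n)\<^sup>2)) \<le> (\<Sum>k=1..n. \<alpha>\<^sup>2 * real n / (2 * (real n)\<^sup>2))"
    using n by (intro sum_mono divide_right_mono mult_left_mono) auto
  also have "\<dots> = \<alpha>\<^sup>2 / 2"
    using n by (simp add: power2_eq_square)
  finally have 3: "(\<Sum>k=1..n. \<alpha>\<^sup>2 * real k / (2 * (real n)\<^sup>2)) \<le> \<alpha>\<^sup>2 / 2" .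
  have "exp (\<Sum>k=1..n. - \<beta> / real k + ?E / (real k)\<^sup>2 + \<alpha>\<^sup>2 * real k / (2 * (real n)\<^sup>2))
      \<le> exp ((2 * ?E + \<alpha>\<^sup>2 / 2) + - \<beta> * ln (real n))"
    unfolding sum.distrib exp_le_cancel_iff using 1 2 3 by linarith
  also have "\<dots> = small_ball_const \<alpha> * real n powr (- \<beta>)"
    unfolding exp_add small_ball_const_def using n by (simp add: powr_def)
  finally show ?thesis .
qed

context random_phases begin

text \<open>
  By independence the expectation is a product over the phases. For \<open>s = t\<close> this is the moment of
  order \<open>h\<close> of the weight at one point; in general it is that moment times the mean of \<open>Q(t)/Q(s)\<close>
  under the law tilted by \<open>Q(s)\<^sup>h\<close>.
\<close>

lemma tilted_weight_le:
  assumes h: "0 < h" "h < 1" and n: "n \<ge> 1" and st: "dist s t \<le> 1 / real n"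
  shows "(\<integral>\<^sup>+x. ennreal (chaos_weight \<alpha> (\<lambda>n. \<omega> n x) n s powr (h - 1) * chaos_weight \<alpha> (\<lambda>n. \<omega> n x) n t) \<partial>M)
    \<le> ennreal (small_ball_const \<alpha> * real n powr (- (h * (1 - h) * \<alpha>\<^sup>2 / 4)))"
proof -
  define \<beta> where "\<beta> = h * (1 - h) * \<alpha>\<^sup>2 / 4"
  have \<beta>: "0 \<le> \<beta>" using h by (simp add: \<beta>_def)
  define a where "a k = \<alpha> / sqrt (real k)" for k
  define f where "f k u = (exp (a k * torus_cos (torus_multiple k s + u)) / bessel_I0 (a k)) powr (h - 1)
      * (exp (a k * torus_cos (torus_multiple k t + u)) / bessel_I0 (a k))" for k u
  have f_nonneg: "0 \<le> f k u" for k u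
    unfolding f_def using bessel_I0_pos[of "a k"] by simp
  have fm [measurable]: "f k \<in> borel_measurable borel" for k
    unfolding f_def torus_cos_add by measurable
  define b where "b k = - \<beta> / real k + \<alpha> ^ 4 * (exp (\<alpha>\<^sup>2 / 2) + 1) / (real k)\<^sup>2
           + \<alpha>\<^sup>2 * real k / (2 * (real n)\<^sup>2)" for k
  have phase: "(\<integral>\<^sup>+x. ennreal (f k (\<omega> k x)) \<partial>M) \<le> ennreal (exp (b k))" if k: "k \<in> {1..n}" for k
  proof -
    let ?c = "torus_cos (torus_multiple k s) * torus_cos (torus_multiple k t)
      + torus_sin (torus_multiple k s) * torus_sin (torus_multiple k t)"
    have a2: "(a k)\<^sup>2 = \<alpha>\<^sup>2 / real k"
      by (simp add: a_def power_divide)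
    have a4: "(a k) ^ 4 = \<alpha> ^ 4 / (real k)\<^sup>2"
    proof -
      have "(a k) ^ 4 = ((a k)\<^sup>2)\<^sup>2" by simp
      then show ?thesis unfolding a2 by (simp add: power_divide)
    qed
    have "2 * (1 - ?c) \<le> (real k * dist s t)\<^sup>2"
      by (rule torus_cos_multiple_diff)
    also have "\<dots> \<le> (real k * (1 / real n))\<^sup>2"
      using st by (intro power_mono mult_left_mono) auto
    finally have c: "1 - ?c \<le> (real k)\<^sup>2 / (2 * (real n)\<^sup>2)"
      by (simp add: power_divide)
    have "(a k)\<^sup>2 * (1 - ?c) \<le> \<alpha>\<^sup>2 / real k * ((real k)\<^sup>2 / (2 * (real n)\<^sup>2))"
      unfolding a2 using c by (intro mult_left_mono) auto
    also have "\<dots> = \<alpha>\<^sup>2 * real k / (2 * (real n)\<^sup>2)"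
      using k by (simp add: power2_eq_square)
    finally have t3: "(a k)\<^sup>2 * (1 - ?c) \<le> \<alpha>\<^sup>2 * real k / (2 * (real n)\<^sup>2)" .
    have "\<alpha>\<^sup>2 / real k \<le> \<alpha>\<^sup>2"
      using k by (simp add: field_simps mult_le_cancel_right1)
    then have t2: "(a k) ^ 4 * (exp ((a k)\<^sup>2 / 2) + 1) \<le> \<alpha> ^ 4 * (exp (\<alpha>\<^sup>2 / 2) + 1) / (real k)\<^sup>2"
      unfolding a4 a2 times_divide_eq_left
      by (intro divide_right_mono mult_left_mono) auto
    have t1: "- h * (1 - h) * (a k)\<^sup>2 / 4 = - \<beta> / real k"
      by (simp add: a2 \<beta>_def)
    have "(\<integral>\<^sup>+x. ennreal (f k (\<omega> k x)) \<partial>M) = (\<integral>\<^sup>+u. ennreal (f k u) \<partial>torus_uniform)"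
      using k by (intro nn_integral_phase) auto
    also have "\<dots> \<le> ennreal (exp (- h * (1 - h) * (a k)\<^sup>2 / 4
        + (a k) ^ 4 * (exp ((a k)\<^sup>2 / 2) + 1) + (a k)\<^sup>2 * (1 - ?c)))"
      unfolding f_def by (rule tilted_phase_le[OF h])
    also have "\<dots> \<le> ennreal (exp (b k))"
      unfolding b_def t1 using t2 t3 by (intro ennreal_leI) simp
    finally show ?thesis .
  qed
  have "chaos_weight \<alpha> (\<lambda>n. \<omega> n x) n s powr (h - 1) * chaos_weight \<alpha> (\<lambda>n. \<omega> n x) n t
      = (\<Prod>k=1..n. f k (\<omega> k x))" for x
    unfolding chaos_weight_def f_def a_def prod.distrib
    by (subst prod_powr_distrib) (auto intro!: divide_nonneg_pos bessel_I0_pos)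
  then have "(\<integral>\<^sup>+x. ennreal (chaos_weight \<alpha> (\<lambda>n. \<omega> n x) n s powr (h - 1) * chaos_weight \<alpha> (\<lambda>n. \<omega> n x) n t) \<partial>M)
      = (\<integral>\<^sup>+x. (\<Prod>k=1..n. ennreal (f k (\<omega> k x))) \<partial>M)"
    using f_nonneg by (simp add: prod_ennreal)
  also have "\<dots> = (\<Prod>k=1..n. \<integral>\<^sup>+x. ennreal (f k (\<omega> k x)) \<partial>M)"
  proof (rule indep_vars_nn_integral)
    have "indep_vars (\<lambda>_. borel) \<omega> {1..n}"
      using indep by (rule indep_vars_subset) auto
    then show "indep_vars (\<lambda>_. borel) (\<lambda>k x. ennreal (f k (\<omega> k x))) {1..n}"
      by (rule indep_vars_compose2) simp
  qed auto
  also have "\<dots> \<le> (\<Prod>k=1..n. ennreal (exp (b k)))"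
    by (intro prod_mono_ennreal phase)
  also have "\<dots> = ennreal (exp (\<Sum>k=1..n. b k))"
    by (simp add: prod_ennreal exp_sum)
  also have "\<dots> \<le> ennreal (small_ball_const \<alpha> * real n powr (- \<beta>))"
    unfolding b_def by (intro ennreal_leI sum_phase_exponents_le n \<beta>)
  finally show ?thesis by (simp add: \<beta>_def)
qed

text \<open>
  The tangent to \<open>y \<mapsto> y\<^sup>h\<close> is taken at the random point \<open>\<sigma>(B) Q\<^sub>n(s)\<close>, the mass the ball would have
  if the weight were constant on it. Both terms of the tangent are then tilted expectations.
\<close>

lemma chaos_mass_small_ball:
  assumes \<sigma>: "finite_measure \<sigma>" "sets \<sigma> = sets borel" "B \<in> sets borel"
    and h: "0 < h" "h < 1" and n: "n \<ge> 1" and ball: "\<And>t. t \<in> B \<Longrightarrow> dist s t \<le> 1 / real n"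
  shows "(\<integral>\<^sup>+x. ennreal (chaos_mass \<alpha> \<sigma> B (\<lambda>n. \<omega> n x) n powr h) \<partial>M)
    \<le> ennreal (small_ball_const \<alpha> * real n powr (- (h * (1 - h) * \<alpha>\<^sup>2 / 4)) * measure \<sigma> B powr h)"
proof -
  interpret \<sigma>: finite_measure \<sigma> by fact
  interpret pair_sigma_finite M \<sigma> ..
  note [measurable_cong] = \<sigma>(2) and [measurable] = \<sigma>(3)
  define W where "W = (\<lambda>x n. \<omega> n x)"
  define b where "b = measure \<sigma> B"
  define D where "D = small_ball_const \<alpha> * real n powr (- (h * (1 - h) * \<alpha>\<^sup>2 / 4))"
  define Q where "Q x = chaos_weight \<alpha> (W x) n s" for x
  define Y where "Y x = chaos_mass \<alpha> \<sigma> B (W x) n" for x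
  have D: "0 \<le> D" by (simp add: D_def small_ball_const_def)
  have Q: "0 < Q x" for x by (simp add: Q_def chaos_weight_pos)
  have Y: "0 \<le> Y x" for x by (simp add: Y_def chaos_mass_nonneg)
  have [measurable]: "Q \<in> borel_measurable M"
    unfolding Q_def W_def by (rule measurable_chaos_weight) (auto intro: measurable_phase)
  have [measurable]: "Y \<in> borel_measurable M"
    unfolding Y_def W_def by (rule measurable_chaos_mass_phases[OF \<sigma>])
  have "(\<lambda>p. chaos_weight \<alpha> (W (fst p)) n (snd p)) \<in> borel_measurable (M \<Otimes>\<^sub>M \<sigma>)"
  proof (rule measurable_chaos_weight)
    fix k assume "k \<in> {1..n}"
    then have [measurable]: "\<omega> k \<in> borel_measurable M" by (intro measurable_phase) auto
    show "(\<lambda>p. W (fst p) k) \<in> borel_measurable (M \<Otimes>\<^sub>M \<sigma>)"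
      unfolding W_def by measurable
  qed measurable
  note [measurable] = this
  have nnY: "ennreal (Y x) = (\<integral>\<^sup>+t. ennreal (chaos_weight \<alpha> (W x) n t) * indicator B t \<partial>\<sigma>)" for x
    unfolding Y_def by (rule ennreal_chaos_mass[OF \<sigma>])
  have tilt: "(\<integral>\<^sup>+x. ennreal (Q x powr (h - 1) * chaos_weight \<alpha> (W x) n t) \<partial>M) \<le> ennreal D"
    if "dist s t \<le> 1 / real n" for t
    unfolding Q_def W_def D_def by (rule tilted_weight_le[OF h n that])
  have "(\<integral>\<^sup>+x. ennreal (Y x powr h) \<partial>M) \<le> ennreal (D * b powr h)"
  proof (cases "b = 0")
    case True
    then have "emeasure \<sigma> B = 0" by (simp add: b_def \<sigma>.emeasure_eq_measure)
    then have "AE t in \<sigma>. t \<notin> B"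
      using \<sigma>(2,3) by (intro AE_not_in) auto
    then have "ennreal (Y x) = 0" for x
      unfolding nnY by (subst nn_integral_cong_AE[where v = "\<lambda>_. 0"]) auto
    then have "Y x = 0" for x using Y[of x] by (metis ennreal_eq_0_iff order_antisym)
    then show ?thesis using h by simp
  next
    case False
    then have b: "0 < b" by (simp add: b_def less_le)
    have pw: "ennreal (Y x powr h) \<le> ennreal ((1 - h) * b powr h) * ennreal (Q x powr (h - 1) * Q x)
        + ennreal (h * b powr (h - 1)) * (ennreal (Q x powr (h - 1)) * ennreal (Y x))" for x
    proof -
      have Qh: "Q x powr h = Q x powr (h - 1) * Q x"
        using Q[of x] by (simp add: powr_diff)
      have "Y x powr h \<le> (1 - h) * (b * Q x) powr h + h * ((b * Q x) powr (h - 1) * Y x)"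
        using b Q[of x] by (intro powr_le_tangent h Y) auto
      also have "\<dots> = (1 - h) * b powr h * (Q x powr (h - 1) * Q x)
          + h * b powr (h - 1) * (Q x powr (h - 1) * Y x)"
        using b Q[of x] by (simp add: powr_mult Qh)
      finally have "ennreal (Y x powr h) \<le> ennreal ((1 - h) * b powr h * (Q x powr (h - 1) * Q x)
          + h * b powr (h - 1) * (Q x powr (h - 1) * Y x))"
        by (rule ennreal_leI)
      also have "\<dots> = ennreal ((1 - h) * b powr h) * ennreal (Q x powr (h - 1) * Q x)
        + ennreal (h * b powr (h - 1)) * (ennreal (Q x powr (h - 1)) * ennreal (Y x))"
        using h Q[of x] Y[of x] by (simp add: ennreal_plus ennreal_mult' less_imp_le)
      finally show ?thesis .
    qed
    have EQ: "(\<integral>\<^sup>+x. ennreal (Q x powr (h - 1) * Q x) \<partial>M) \<le> ennreal D"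
      using tilt[of s] by (simp add: Q_def)
    have "(\<integral>\<^sup>+x. ennreal (Q x powr (h - 1)) * ennreal (Y x) \<partial>M)
        = (\<integral>\<^sup>+x. \<integral>\<^sup>+t. ennreal (Q x powr (h - 1)) * (ennreal (chaos_weight \<alpha> (W x) n t) * indicator B t) \<partial>\<sigma> \<partial>M)"
    proof (rule nn_integral_cong)
      fix x
      have [measurable]: "chaos_weight \<alpha> (W x) n \<in> borel_measurable \<sigma>"
        using measurable_chaos_weight[of n "\<lambda>_. W x" \<sigma> "\<lambda>t. t" \<alpha>] measurable_ident_sets[OF \<sigma>(2)] by simp
      show "ennreal (Q x powr (h - 1)) * ennreal (Y x)
        = (\<integral>\<^sup>+t. ennreal (Q x powr (h - 1)) * (ennreal (chaos_weight \<alpha> (W x) n t) * indicator B t) \<partial>\<sigma>)"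
        unfolding nnY by (rule nn_integral_cmult[symmetric]) measurable
    qed
    also have "\<dots> = (\<integral>\<^sup>+t. \<integral>\<^sup>+x. ennreal (Q x powr (h - 1)) * (ennreal (chaos_weight \<alpha> (W x) n t) * indicator B t) \<partial>M \<partial>\<sigma>)"
      by (rule Fubini'[symmetric]) (simp add: split_beta)
    also have "\<dots> \<le> (\<integral>\<^sup>+t. ennreal D * indicator B t \<partial>\<sigma>)"
    proof (rule nn_integral_mono)
      fix t
      show "(\<integral>\<^sup>+x. ennreal (Q x powr (h - 1)) * (ennreal (chaos_weight \<alpha> (W x) n t) * indicator B t) \<partial>M)
        \<le> ennreal D * indicator B t"
        using tilt[of t] ball[of t]
        by (cases "t \<in> B") (simp_all add: ennreal_mult less_imp_le[OF chaos_weight_pos])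
    qed
    also have "\<dots> = ennreal (D * b)"
      using D by (subst nn_integral_cmult_indicator)
        (auto simp: \<sigma>(2) \<sigma>(3) b_def \<sigma>.emeasure_eq_measure ennreal_mult)
    finally have EY: "(\<integral>\<^sup>+x. ennreal (Q x powr (h - 1)) * ennreal (Y x) \<partial>M) \<le> ennreal (D * b)" .
    have "(\<integral>\<^sup>+x. ennreal (Y x powr h) \<partial>M)
        \<le> (\<integral>\<^sup>+x. ennreal ((1 - h) * b powr h) * ennreal (Q x powr (h - 1) * Q x)
        + ennreal (h * b powr (h - 1)) * (ennreal (Q x powr (h - 1)) * ennreal (Y x)) \<partial>M)"
      by (rule nn_integral_mono) (rule pw)
    also have "\<dots> = ennreal ((1 - h) * b powr h) * (\<integral>\<^sup>+x. ennreal (Q x powr (h - 1) * Q x) \<partial>M)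
        + ennreal (h * b powr (h - 1)) * (\<integral>\<^sup>+x. ennreal (Q x powr (h - 1)) * ennreal (Y x) \<partial>M)"
      by (subst nn_integral_add) (auto simp: nn_integral_cmult)
    also have "\<dots> \<le> ennreal ((1 - h) * b powr h) * ennreal D + ennreal (h * b powr (h - 1)) * ennreal (D * b)"
      by (intro add_mono mult_left_mono EQ EY) auto
    also have "\<dots> = ennreal ((1 - h) * b powr h * D + h * b powr (h - 1) * (D * b))"
      using h D b by (simp add: ennreal_plus ennreal_mult')
    also have "(1 - h) * b powr h * D + h * b powr (h - 1) * (D * b) = D * b powr h"
      using b by (simp add: powr_diff field_simps)
    finally show ?thesis .
  qed
  then show ?thesis by (simp add: Y_def W_def D_def b_def)
qed

text \<open>
  The moments bound the probability that the mass ever returns above a level after time \<open>m\<close>; as they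
  become arbitrarily small, almost surely every positive level is exceeded only finitely often.
\<close>

lemma chaos_mass_tendsto_0:
  assumes \<sigma>: "finite_measure \<sigma>" "sets \<sigma> = sets borel" "B \<in> sets borel"
    and h: "0 < h" "h < 1"
    and small: "\<And>e. 0 < e \<Longrightarrow>
      \<exists>m. (\<integral>\<^sup>+x. ennreal (chaos_mass \<alpha> \<sigma> B (\<lambda>n. \<omega> n x) m powr h) \<partial>M) \<le> ennreal e"
  shows "AE x in M. (\<lambda>N. chaos_mass \<alpha> \<sigma> B (\<lambda>n. \<omega> n x) N) \<longlonglongrightarrow> 0"
proof -
  define Y where "Y N x = chaos_mass \<alpha> \<sigma> B (\<lambda>n. \<omega> n x) N" for N x
  have [measurable]: "Y N \<in> borel_measurable M" for N
    unfolding Y_def by (rule measurable_chaos_mass_phases[OF \<sigma>])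
  have ev: "AE x in M. \<forall>\<^sub>F N in sequentially. Y N x powr h < c" if c: "0 < c" for c
  proof -
    define A where "A = {x \<in> space M. \<forall>m. \<exists>k\<ge>m. c \<le> Y k x powr h}"
    have [measurable]: "A \<in> sets M" unfolding A_def by measurable
    have "ennreal c * emeasure M A \<le> ennreal e" if e: "0 < e" for e
    proof -
      obtain m where m: "(\<integral>\<^sup>+x. ennreal (Y m x powr h) \<partial>M) \<le> ennreal e"
        using small[OF e] by (auto simp: Y_def)
      define C where "C N = {x \<in> space M. \<exists>k\<in>{m..m + N}. c \<le> Y k x powr h}" for N
      have [measurable]: "C N \<in> sets M" for N unfolding C_def by measurable
      have "incseq C"
        unfolding C_def by (intro incseq_SucI) fastforce
      then have "(SUP N. emeasure M (C N)) = emeasure M (\<Union>N. C N)"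
        by (intro SUP_emeasure_incseq) auto
      moreover have "A \<subseteq> (\<Union>N. C N)"
      proof
        fix x assume "x \<in> A"
        then obtain k where "x \<in> space M" "m \<le> k" "c \<le> Y k x powr h" by (auto simp: A_def)
        then have "x \<in> C (k - m)" by (auto simp: C_def intro!: bexI[of _ k])
        then show "x \<in> (\<Union>N. C N)" by blast
      qed
      ultimately have "ennreal c * emeasure M A \<le> ennreal c * (SUP N. emeasure M (C N))"
        by (auto intro!: mult_left_mono emeasure_mono)
      also have "\<dots> = (SUP N. ennreal c * emeasure M (C N))"
        by (rule SUP_mult_left_ennreal)
      also have "\<dots> \<le> (\<integral>\<^sup>+x. ennreal (Y m x powr h) \<partial>M)"
        unfolding C_def Y_def using c
        by (intro SUP_least chaos_mass_maximal_inequality[OF \<sigma> h]) auto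
      finally show ?thesis using m by (rule order_trans)
    qed
    then have "ennreal c * emeasure M A \<le> 0"
      using ennreal_le_epsilon[of 0 "ennreal c * emeasure M A"] by simp
    then have "A \<in> null_sets M" using c by (auto simp: null_sets_def)
    then have "AE x in M. x \<notin> A" by (rule AE_not_in)
    then show ?thesis
    proof (rule AE_mp, intro AE_I2 impI)
      fix x assume "x \<in> space M" "x \<notin> A"
      then have "\<not> (\<forall>m. \<exists>k\<ge>m. c \<le> Y k x powr h)"
        by (simp add: A_def)
      then obtain m where "\<not> (\<exists>k\<ge>m. c \<le> Y k x powr h)"
        by blast
      then have "Y k x powr h < c" if "m \<le> k" for k
        using that by (meson linorder_not_le)
      then show "\<forall>\<^sub>F N in sequentially. Y N x powr h < c"
        unfolding eventually_sequentially by blast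
    qed
  qed
  have "AE x in M. \<forall>j. \<forall>\<^sub>F N in sequentially. Y N x powr h < 1 / real (Suc j)"
    unfolding AE_all_countable by (intro allI ev) simp
  then show ?thesis
  proof eventually_elim
    fix x assume x: "\<forall>j. \<forall>\<^sub>F N in sequentially. Y N x powr h < 1 / real (Suc j)"
    have "\<forall>\<^sub>F N in sequentially. dist (Y N x) 0 < e" if e: "0 < e" for e
    proof -
      obtain j where j: "1 / real (Suc j) < e powr h"
        using e nat_approx_posE[of "e powr h"] by auto
      from x have "\<forall>\<^sub>F N in sequentially. Y N x powr h < 1 / real (Suc j)" by blast
      then show ?thesis
      proof eventually_elim
        fix N assume "Y N x powr h < 1 / real (Suc j)"
        then have "Y N x powr h < e powr h" using j by simp
        then have "Y N x < e"
          using powr_mono2[of h e "Y N x"] h e by (force simp: not_less)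
        then show "dist (Y N x) 0 < e"
          by (simp add: Y_def chaos_mass_nonneg)
      qed
    qed
    then show "(\<lambda>N. chaos_mass \<alpha> \<sigma> B (\<lambda>n. \<omega> n x) N) \<longlonglongrightarrow> 0"
      by (intro tendstoI) (simp add: Y_def)
  qed
qed

end

section \<open>Hausdorff coverings and subadditivity\<close>

lemma hausdorff_gauge_pos: "0 < s \<Longrightarrow> hausdorff_gauge s U = ennreal (diameter U powr s)"
  by (auto simp: hausdorff_gauge_def)

text \<open>
  A set of a covering lies in the closed ball around any of its points whose radius is its diameter.
  The radii are enlarged slightly, because sets of diameter zero must receive a positive radius: the
  radius determines at which time the weight is compared on the ball.
\<close>

lemma hausdorff_null_imp_ball_cover:
  fixes E :: "'a::metric_space set"
  assumes s: "0 < s" and null: "hausdorff_measure s E = 0" and \<epsilon>: "0 < \<epsilon>"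
  obtains x :: "nat \<Rightarrow> 'a" and r :: "nat \<Rightarrow> real"
  where "\<And>i. 0 < r i" "E \<subseteq> (\<Union>i. cball (x i) (r i))"
    "summable (\<lambda>i. r i powr s)" "(\<Sum>i. r i powr s) \<le> \<epsilon>"
proof -
  have "hausdorff_premeasure s 1 E \<le> hausdorff_measure s E"
    unfolding hausdorff_measure_def by (rule SUP_upper) simp
  then have "hausdorff_premeasure s 1 E < ennreal (\<epsilon> / 2)"
    using null \<epsilon> by simp
  then obtain U where U: "E \<subseteq> (\<Union>i. U i)" "\<And>i. bounded (U i)"
    and sum: "(\<Sum>i. hausdorff_gauge s (U i)) < ennreal (\<epsilon> / 2)"
    unfolding hausdorff_premeasure_def INF_less_iff by auto
  define d where "d i = diameter (U i)" for i
  have d: "0 \<le> d i" for i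
    unfolding d_def using U(2) by (rule diameter_ge_0)
  have sum': "(\<Sum>i. ennreal (d i powr s)) < ennreal (\<epsilon> / 2)"
    using sum s by (simp add: hausdorff_gauge_pos d_def)
  then have summ: "summable (\<lambda>i. d i powr s)"
    by (intro summable_suminf_not_top) auto
  have sum_d: "(\<Sum>i. d i powr s) \<le> \<epsilon> / 2"
  proof -
    have "ennreal (\<Sum>i. d i powr s) < ennreal (\<epsilon> / 2)"
      using sum' summ by (simp add: suminf_ennreal2)
    then show ?thesis using \<epsilon> by (simp add: ennreal_less_iff suminf_nonneg[OF summ])
  qed
  \<comment> \<open>The added geometric series contributes \<open>\<epsilon>/2\<close> in total.\<close>
  define g where "g i = d i powr s + \<epsilon> / 2 * (1 / 2) ^ Suc i" for i
  define r where "r i = g i powr (1 / s)" for i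
  define x where "x i = (SOME y. y \<in> U i)" for i
  have g: "0 < g i" for i
    unfolding g_def using \<epsilon> by (intro add_nonneg_pos) auto
  have rs: "r i powr s = g i" for i
    using g[of i] s by (simp add: r_def powr_powr)
  have geo: "(\<lambda>i. \<epsilon> / 2 * (1 / 2) ^ Suc i) sums (\<epsilon> / 2 * 1)"
    by (intro sums_mult power_half_series)
  have gs: "g sums ((\<Sum>i. d i powr s) + \<epsilon> / 2 * 1)"
    unfolding g_def by (intro sums_add geo summable_sums summ)
  show thesis
  proof (rule that)
    show "0 < r i" for i using g[of i] by (simp add: r_def)
    show "summable (\<lambda>i. r i powr s)" using gs by (simp add: rs sums_iff)
    show "(\<Sum>i. r i powr s) \<le> \<epsilon>" using gs sum_d by (simp add: rs sums_iff)
    show "E \<subseteq> (\<Union>i. cball (x i) (r i))"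
    proof
      fix y assume "y \<in> E"
      then obtain i where i: "y \<in> U i" using U by auto
      then have "x i \<in> U i" unfolding x_def by (rule someI)
      then have "dist (x i) y \<le> d i"
        unfolding d_def using U(2) i by (intro diameter_bounded_bound) auto
      also have "\<dots> = (d i powr s) powr (1 / s)"
        using d[of i] s by (simp add: powr_powr)
      also have "\<dots> \<le> r i"
        unfolding r_def g_def using s \<epsilon> by (intro powr_mono2) auto
      finally show "y \<in> (\<Union>i. cball (x i) (r i))" by auto
    qed
  qed
qed

lemma hausdorff_measure_zero_dim_null:
  fixes E :: "'a::metric_space set"
  assumes "hausdorff_measure 0 E = 0"
  shows "E = {}"
proof (rule ccontr)
  assume "E \<noteq> {}"
  have "1 \<le> hausdorff_premeasure 0 1 E"
    unfolding hausdorff_premeasure_def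
  proof (rule INF_greatest)
    fix U :: "nat \<Rightarrow> 'a set"
    assume "U \<in> {U. E \<subseteq> (\<Union>i. U i) \<and> (\<forall>i. bounded (U i) \<and> diameter (U i) \<le> 1)}"
    then obtain i where "U i \<noteq> {}" using \<open>E \<noteq> {}\<close> by fastforce
    then have "1 = hausdorff_gauge 0 (U i)" by (simp add: hausdorff_gauge_def)
    also have "\<dots> \<le> (\<Sum>i. hausdorff_gauge 0 (U i))"
      using sum_le_suminf[of "\<lambda>i. hausdorff_gauge 0 (U i)" "{i}"] by simp
    finally show "1 \<le> (\<Sum>i. hausdorff_gauge 0 (U i))" .
  qed
  also have "\<dots> \<le> hausdorff_measure 0 E"
    unfolding hausdorff_measure_def by (rule SUP_upper) simp
  finally show False using assms by simp
qed

text \<open>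
  The circle is covered by \<open>n\<close> arcs of length \<open>2\<pi>/n\<close>, and \<open>n (2\<pi>/n)\<^sup>s\<close> tends to zero.
\<close>

lemma hausdorff_measure_torus:
  assumes s: "1 < s"
  shows "hausdorff_measure s (UNIV :: torus set) = 0"
proof -
  have small: "hausdorff_premeasure s \<delta> (UNIV :: torus set) \<le> 0 + ennreal \<epsilon>" if \<delta>: "0 < \<delta>" and \<epsilon>: "0 < \<epsilon>" for \<delta> \<epsilon>
  proof -
    have "(\<lambda>n. (2 * pi) powr s * real n powr (1 - s)) \<longlonglongrightarrow> (2 * pi) powr s * 0"
      using s by (intro tendsto_mult tendsto_const tendsto_neg_powr filterlim_real_sequentially) auto
    then have "\<forall>\<^sub>F n in sequentially. (2 * pi) powr s * real n powr (1 - s) < \<epsilon>"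
      using \<epsilon> by (intro order_tendstoD) auto
    moreover have "(\<lambda>n. 2 * pi / real n) \<longlonglongrightarrow> 0"
      by (rule lim_const_over_n)
    then have "\<forall>\<^sub>F n in sequentially. 2 * pi / real n < \<delta>"
      using \<delta> by (intro order_tendstoD) auto
    ultimately have "\<forall>\<^sub>F n in sequentially. 1 \<le> n \<and> 2 * pi / real n < \<delta>
        \<and> (2 * pi) powr s * real n powr (1 - s) < \<epsilon>"
      using eventually_ge_at_top[of 1] by eventually_elim simp
    then obtain n :: nat where n: "1 \<le> n" "2 * pi / real n < \<delta>"
      "(2 * pi) powr s * real n powr (1 - s) < \<epsilon>"
      by (auto simp: eventually_sequentially)
    define l where "l = 2 * pi / real n"
    have l: "0 < l" using n by (simp add: l_def)
    define U where "U i = (if i < n then torus_proj ` {l * real i..l * real (Suc i)} else {})" for i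
    have UU: "dist a b \<le> l" if "a \<in> U i" "b \<in> U i" for a b i
    proof -
      have "a \<in> torus_proj ` {l * real i..l * real (Suc i)}" "b \<in> torus_proj ` {l * real i..l * real (Suc i)}"
        using that by (simp_all only: U_def split: if_splits) auto
      then obtain x y where "a = torus_proj x" "x \<in> {l * real i..l * real (Suc i)}"
        "b = torus_proj y" "y \<in> {l * real i..l * real (Suc i)}"
        by (elim imageE)
      moreover have "l * real (Suc i) = l * real i + l" by (simp add: algebra_simps)
      ultimately have "\<bar>x - y\<bar> \<le> l" unfolding atLeastAtMost_iff by linarith
      with dist_torus_proj_le[of x y] show ?thesis
        unfolding \<open>a = torus_proj x\<close> \<open>b = torus_proj y\<close> by linarith
    qed
    have diam: "diameter (U i) \<le> l" for i
      unfolding diameter_def using l by (auto intro!: cSUP_least UU)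
    have diam_le: "diameter (U i) \<le> \<delta>" for i
      using diam[of i] n(2) by (simp add: l_def)
    have bdd: "bounded (U i)" for i
      unfolding bounded_two_points using UU by (intro exI[of _ l]) simp
    have cover: "UNIV \<subseteq> (\<Union>i. U i)"
    proof
      fix t :: torus
      obtain c where c: "0 \<le> c" "c < 2 * pi" "t = torus_proj c"
        by (rule torus_proj_surj_fundamental)
      define i where "i = nat \<lfloor>c / l\<rfloor>"
      have i: "real i \<le> c / l" "c / l < real i + 1"
        using c l by (simp_all add: i_def)
      then have "l * real i \<le> c" "c \<le> l * real (Suc i)"
        using l by (simp_all add: field_simps)
      moreover have "real i < real n"
      proof -
        have "c / l < 2 * pi / l" using c l by (intro divide_strict_right_mono)
        also have "2 * pi / l = real n" using n by (simp add: l_def)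
        finally show ?thesis using i by simp
      qed
      ultimately have "t \<in> U i" by (auto simp: U_def c)
      then show "t \<in> (\<Union>i. U i)" by blast
    qed
    have "hausdorff_premeasure s \<delta> (UNIV :: torus set) \<le> (\<Sum>i. hausdorff_gauge s (U i))"
      unfolding hausdorff_premeasure_def
      using cover bdd diam_le by (intro INF_lower) auto
    also have "\<dots> = (\<Sum>i<n. hausdorff_gauge s (U i))"
      by (rule suminf_finite) (auto simp: U_def hausdorff_gauge_def)
    also have "\<dots> \<le> (\<Sum>i<n. ennreal (l powr s))"
      using s diam diameter_ge_0[OF bdd] by (intro sum_mono) (auto simp: hausdorff_gauge_pos intro!: ennreal_leI powr_mono2)
    also have "\<dots> = ennreal (real n * l powr s)"
      by (simp add: ennreal_mult ennreal_of_nat_eq_real_of_nat)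
    also have "real n * l powr s = (2 * pi) powr s * real n powr (1 - s)"
      using n by (simp add: l_def powr_divide powr_diff)
    also have "ennreal \<dots> \<le> 0 + ennreal \<epsilon>"
      using n(3) by (simp add: ennreal_leI)
    finally show ?thesis .
  qed
  have "hausdorff_premeasure s \<delta> (UNIV :: torus set) \<le> 0" if "0 < \<delta>" for \<delta>
    by (rule ennreal_le_epsilon) (rule small[OF that])
  then have "hausdorff_measure s (UNIV :: torus set) \<le> 0"
    unfolding hausdorff_measure_def by (intro SUP_least) simp
  then show ?thesis
    by simp
qed

lemma powr_add_le:
  fixes a b h :: real
  assumes "0 \<le> a" "0 \<le> b" "0 < h" "h < 1"
  shows "(a + b) powr h \<le> a powr h + b powr h"
proof (cases "a + b = 0")
  case True
  then show ?thesis using assms by simp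
next
  case False
  then have S: "0 < a + b" using assms by simp
  have *: "x \<le> x powr h * (a + b) powr (1 - h)" if "0 \<le> x" "x \<le> a + b" for x
  proof -
    have "x = x powr h * x powr (1 - h)"
      using that by (cases "x = 0") (simp_all flip: powr_add)
    also have "\<dots> \<le> x powr h * (a + b) powr (1 - h)"
      using that assms by (intro mult_left_mono powr_mono2) auto
    finally show ?thesis .
  qed
  have "(a + b) powr h * (a + b) powr (1 - h) = a + b"
    using S by (simp flip: powr_add)
  also have "\<dots> \<le> (a powr h + b powr h) * (a + b) powr (1 - h)"
    using *[of a] *[of b] assms by (simp add: distrib_right)
  finally show ?thesis using S by simp
qed

lemma chaos_mass_disjoint_Un:
  assumes "finite_measure \<sigma>" "sets \<sigma> = sets borel" "A \<in> sets borel" "B \<in> sets borel" "A \<inter> B = {}"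
  shows "chaos_mass \<alpha> \<sigma> (A \<union> B) w N = chaos_mass \<alpha> \<sigma> A w N + chaos_mass \<alpha> \<sigma> B w N"
proof -
  have "chaos_mass \<alpha> \<sigma> (A \<union> B) w N
      = (\<integral>t. chaos_weight \<alpha> w N t * indicator A t + chaos_weight \<alpha> w N t * indicator B t \<partial>\<sigma>)"
    unfolding chaos_mass_def using assms(5)
    by (intro Bochner_Integration.integral_cong) (auto simp: indicator_def)
  then show ?thesis
    unfolding chaos_mass_def using assms
    by (simp add: integrable_chaos_weight Bochner_Integration.integral_add)
qed

lemma chaos_mass_0: "B \<in> sets \<sigma> \<Longrightarrow> chaos_mass \<alpha> \<sigma> B w 0 = measure \<sigma> B"
  by (simp add: chaos_mass_def)

context random_phases begin

lemma chaos_mass_powr_Un_le: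
  assumes \<sigma>: "finite_measure \<sigma>" "sets \<sigma> = sets borel" and AB: "A \<in> sets borel" "B \<in> sets borel" "A \<inter> B = {}"
    and h: "0 < h" "h < 1"
  shows "(\<integral>\<^sup>+x. ennreal (chaos_mass \<alpha> \<sigma> (A \<union> B) (\<lambda>n. \<omega> n x) N powr h) \<partial>M)
    \<le> (\<integral>\<^sup>+x. ennreal (chaos_mass \<alpha> \<sigma> A (\<lambda>n. \<omega> n x) N powr h) \<partial>M)
      + (\<integral>\<^sup>+x. ennreal (chaos_mass \<alpha> \<sigma> B (\<lambda>n. \<omega> n x) N powr h) \<partial>M)"
proof -
  note [measurable] = measurable_chaos_mass_phases[OF \<sigma> AB(1)] measurable_chaos_mass_phases[OF \<sigma> AB(2)]
  have "(\<integral>\<^sup>+x. ennreal (chaos_mass \<alpha> \<sigma> (A \<union> B) (\<lambda>n. \<omega> n x) N powr h) \<partial>M)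
    \<le> (\<integral>\<^sup>+x. ennreal (chaos_mass \<alpha> \<sigma> A (\<lambda>n. \<omega> n x) N powr h)
        + ennreal (chaos_mass \<alpha> \<sigma> B (\<lambda>n. \<omega> n x) N powr h) \<partial>M)"
    unfolding chaos_mass_disjoint_Un[OF \<sigma> AB]
    by (intro nn_integral_mono) (simp add: powr_add_le chaos_mass_nonneg h flip: ennreal_plus)
  also have "\<dots> = (\<integral>\<^sup>+x. ennreal (chaos_mass \<alpha> \<sigma> A (\<lambda>n. \<omega> n x) N powr h) \<partial>M)
      + (\<integral>\<^sup>+x. ennreal (chaos_mass \<alpha> \<sigma> B (\<lambda>n. \<omega> n x) N powr h) \<partial>M)"
    by (rule nn_integral_add) measurable
  finally show ?thesis .
qed

lemma chaos_mass_powr_Union_le: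
  fixes B :: "nat \<Rightarrow> torus set"
  assumes \<sigma>: "finite_measure \<sigma>" "sets \<sigma> = sets borel" and B: "\<And>i. B i \<in> sets borel" "disjoint_family B"
    and h: "0 < h" "h < 1"
  shows "(\<integral>\<^sup>+x. ennreal (chaos_mass \<alpha> \<sigma> (\<Union>i<m. B i) (\<lambda>n. \<omega> n x) N powr h) \<partial>M)
    \<le> (\<Sum>i<m. \<integral>\<^sup>+x. ennreal (chaos_mass \<alpha> \<sigma> (B i) (\<lambda>n. \<omega> n x) N powr h) \<partial>M)"
proof (induction m)
  case 0
  then show ?case by (simp add: chaos_mass_def)
next
  case (Suc m)
  have "B i \<inter> B m = {}" if "i < m" for i
    using B(2) that by (simp add: disjoint_family_on_def)
  then have "(\<Union>i<m. B i) \<inter> B m = {}"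
    by blast
  then have "(\<integral>\<^sup>+x. ennreal (chaos_mass \<alpha> \<sigma> ((\<Union>i<m. B i) \<union> B m) (\<lambda>n. \<omega> n x) N powr h) \<partial>M)
    \<le> (\<integral>\<^sup>+x. ennreal (chaos_mass \<alpha> \<sigma> (\<Union>i<m. B i) (\<lambda>n. \<omega> n x) N powr h) \<partial>M)
      + (\<integral>\<^sup>+x. ennreal (chaos_mass \<alpha> \<sigma> (B m) (\<lambda>n. \<omega> n x) N powr h) \<partial>M)"
    using B by (intro chaos_mass_powr_Un_le[OF \<sigma> _ _ _ h]) auto
  also have "\<dots> \<le> (\<Sum>i<m. \<integral>\<^sup>+x. ennreal (chaos_mass \<alpha> \<sigma> (B i) (\<lambda>n. \<omega> n x) N powr h) \<partial>M)
      + (\<integral>\<^sup>+x. ennreal (chaos_mass \<alpha> \<sigma> (B m) (\<lambda>n. \<omega> n x) N powr h) \<partial>M)"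
    by (intro add_right_mono Suc.IH)
  finally show ?case by (simp add: lessThan_Suc Un_commute add.commute)
qed

end

section \<open>Degeneracy on sets of small dimension\<close>

text \<open>
  Weighted arithmetic-geometric mean inequality with a parameter. Summed over families with
  \<open>\<Sum> b \<le> 1\<close> and \<open>\<Sum> y \<le> \<eta>\<close> it is Hoelder's inequality with exponents \<open>1/h\<close> and \<open>1/(1 - h)\<close>.
\<close>

lemma powr_mult_powr_le_tangent:
  fixes b y \<eta> h :: real
  assumes h: "0 < h" "h < 1" and "0 \<le> b" "0 < y" "0 < \<eta>"
  shows "b powr h * y powr (1 - h) \<le> \<eta> powr (1 - h) * (h * b + (1 - h) * (y / \<eta>))"
proof -
  have "b powr h \<le> (1 - h) * (y / \<eta>) powr h + h * ((y / \<eta>) powr (h - 1) * b)"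
    using assms by (intro powr_le_tangent) auto
  then have "b powr h * y powr (1 - h)
      \<le> ((1 - h) * (y / \<eta>) powr h + h * ((y / \<eta>) powr (h - 1) * b)) * y powr (1 - h)"
    by (intro mult_right_mono) auto
  also have "\<dots> = (1 - h) * ((y / \<eta>) powr h * y powr (1 - h)) + h * b * ((y / \<eta>) powr (h - 1) * y powr (1 - h))"
    by (simp add: algebra_simps)
  also have "(y / \<eta>) powr h * y powr (1 - h) = \<eta> powr (1 - h) * (y / \<eta>)"
    using assms by (simp add: powr_divide powr_diff)
  also have "(y / \<eta>) powr (h - 1) * y powr (1 - h) = \<eta> powr (1 - h)"
    using assms by (simp add: powr_divide powr_diff)
  finally show ?thesis by (simp add: algebra_simps)
qed

text \<open>
  A ball of radius \<open>r\<close> is treated at time \<open>n\<close> with \<open>1/n\<close> comparable to \<open>r\<close>: not smaller than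
  \<open>r\<close>, so that the estimate on small balls applies, and at most \<open>2r\<close>, so that the decay is not lost.
\<close>

lemma exists_scale:
  fixes r :: real
  assumes "0 < r" "r \<le> 1"
  obtains n :: nat where "n \<ge> 1" "r \<le> 1 / real n" "1 / real n \<le> 2 * r"
proof -
  define y where "y = 1 / r"
  define n where "n = nat \<lfloor>y\<rfloor>"
  have "1 \<le> \<lfloor>y\<rfloor>" using assms by (simp add: y_def le_floor_iff)
  then have "1 \<le> n" "real n = of_int \<lfloor>y\<rfloor>" by (auto simp: n_def le_nat_iff)
  then have n: "1 \<le> n" "real n \<le> 1 / r" "1 / r < real n + 1"
    unfolding y_def by linarith+
  show thesis
  proof (rule that)
    show "n \<ge> 1" by fact
    show "r \<le> 1 / real n" using n assms by (simp add: field_simps)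
    have "1 / r < 2 * real n" using n by linarith
    then show "1 / real n \<le> 2 * r" using n assms by (simp add: field_simps)
  qed
qed

context random_phases begin

text \<open>
  The circle is split into finitely many small disjoint pieces \<open>B\<^sub>i\<close> and a remainder of small
  measure. Each piece is estimated at its own time and then carried to a common later time by the
  supermartingale property; the remainder is compared with its measure at time \<open>0\<close>.
\<close>

lemma chaos_mass_powr_small:
  assumes \<sigma>: "prob_space \<sigma>" "sets \<sigma> = sets borel" and E: "E \<in> sets borel" "emeasure \<sigma> E = 1"
    and null: "hausdorff_measure s E = 0" and s: "0 < s" "s < \<alpha>\<^sup>2 / 4"
    and e: "0 < e"
  shows "\<exists>N. (\<integral>\<^sup>+x. ennreal (chaos_mass \<alpha> \<sigma> UNIV (\<lambda>n. \<omega> n x) N powr (4 * s / \<alpha>\<^sup>2)) \<partial>M) \<le> ennreal e"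
proof -
  interpret \<sigma>: prob_space \<sigma> by fact
  have fin: "finite_measure \<sigma>" by (rule \<sigma>.finite_measure)
  define h where "h = 4 * s / \<alpha>\<^sup>2"
  have \<alpha>: "0 < \<alpha>\<^sup>2" using s by linarith
  have h: "0 < h" "h < 1"
    using s \<alpha> by (auto simp: h_def field_simps)
  \<comment> \<open>This identity is the reason for the choice of \<open>h\<close>.\<close>
  have exponent: "h * (1 - h) * \<alpha>\<^sup>2 / 4 = (1 - h) * s"
    using \<alpha> by (simp add: h_def)
  \<comment> \<open>The power of \<open>2\<close> accounts for \<open>1/n\<^sub>i \<le> 2 r\<^sub>i\<close>.\<close>
  define K where "K = small_ball_const \<alpha> * 2 powr ((1 - h) * s)"
  have K: "0 < K" by (simp add: K_def small_ball_const_def)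
  \<comment> \<open>The second argument makes \<open>K * \<eta> powr (1 - h)\<close> at most \<open>e / 2\<close>; the bound \<open>1\<close> keeps the radii at most \<open>1\<close>.\<close>
  define \<eta> where "\<eta> = min 1 ((e / (2 * K)) powr (1 / (1 - h)))"
  have \<eta>: "0 < \<eta>" "\<eta> \<le> 1" using e K by (auto simp: \<eta>_def)
  have K\<eta>: "K * \<eta> powr (1 - h) \<le> e / 2"
  proof -
    have "\<eta> powr (1 - h) \<le> ((e / (2 * K)) powr (1 / (1 - h))) powr (1 - h)"
      using \<eta> h by (intro powr_mono2) (auto simp: \<eta>_def)
    also have "\<dots> = e / (2 * K)" using h e K by (simp add: powr_powr)
    finally show ?thesis using K by (simp add: field_simps)
  qed
  obtain c :: "nat \<Rightarrow> torus" and r where r: "\<And>i. 0 < r i" and cover: "E \<subseteq> (\<Union>i. cball (c i) (r i))"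
    and summ: "summable (\<lambda>i. r i powr s)" and le: "(\<Sum>i. r i powr s) \<le> \<eta>"
    by (rule hausdorff_null_imp_ball_cover[OF s(1) null \<eta>(1)]) blast
  have r1: "r i \<le> 1" for i
  proof -
    have "r i powr s \<le> (\<Sum>i. r i powr s)"
      using sum_le_suminf[OF summ, of "{i}"] by simp
    then have "r i powr s \<le> 1" using le \<eta> by linarith
    then have "(r i powr s) powr (1 / s) \<le> 1 powr (1 / s)"
      using s by (intro powr_mono2) auto
    then show ?thesis using r[of i] s by (simp add: powr_powr)
  qed
  have "\<forall>i. \<exists>n::nat. n \<ge> 1 \<and> r i \<le> 1 / real n \<and> 1 / real n \<le> 2 * r i"
    using exists_scale[OF r r1] by metis
  then obtain n :: "nat \<Rightarrow> nat" where n: "\<And>i. n i \<ge> 1" "\<And>i. r i \<le> 1 / real (n i)" "\<And>i. 1 / real (n i) \<le> 2 * r i"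
    by metis
  define B where "B = disjointed (\<lambda>i. cball (c i) (r i))"
  have B: "B i \<in> sets borel" for i
  proof -
    have "range (\<lambda>i. cball (c i) (r i)) \<subseteq> sets borel" by auto
    from sets.range_disjointed_sets[OF this] show ?thesis unfolding B_def by blast
  qed
  have Bd: "disjoint_family B" unfolding B_def by (rule disjoint_family_disjointed)
  have Bsub: "B i \<subseteq> cball (c i) (r i)" for i
    unfolding B_def by (rule disjointed_subset)
  have Bcov: "E \<subseteq> (\<Union>i. B i)" unfolding B_def using cover by (simp add: UN_disjointed_eq)
  have sB: "B i \<in> sets \<sigma>" for i using B \<sigma>(2) by simp
  have full: "measure \<sigma> (\<Union>i. B i) = 1"
  proof -
    have "emeasure \<sigma> E \<le> emeasure \<sigma> (\<Union>i. B i)"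
      using Bcov sB by (intro emeasure_mono) auto
    then have "1 \<le> measure \<sigma> (\<Union>i. B i)"
      using E(2) by (simp add: \<sigma>.emeasure_eq_measure flip: ennreal_1)
    then show ?thesis using \<sigma>.prob_le_1[of "\<Union>i. B i"] by linarith
  qed
  have sums: "(\<lambda>i. measure \<sigma> (B i)) sums 1"
    using \<sigma>.finite_measure_UNION[of B] sB Bd full by auto
  define R where "R m = UNIV - (\<Union>i<m. B i)" for m :: nat
  have R: "R m \<in> sets borel" for m unfolding R_def using B by auto
  have Rm: "measure \<sigma> (R m) = 1 - (\<Sum>i<m. measure \<sigma> (B i))" for m
  proof -
    have "measure \<sigma> (\<Union>i<m. B i) = (\<Sum>i<m. measure \<sigma> (B i))"
      using sB Bd by (intro \<sigma>.finite_measure_finite_Union) (auto intro: disjoint_family_on_mono)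
    moreover have "R m = space \<sigma> - (\<Union>i<m. B i)"
      using sets_eq_imp_space_eq[OF \<sigma>(2)] by (simp add: R_def)
    moreover have "(\<Union>i<m. B i) \<in> sets \<sigma>" using sB by auto
    ultimately show ?thesis by (simp add: \<sigma>.prob_compl)
  qed
  have "(\<lambda>m. 1 - (\<Sum>i<m. measure \<sigma> (B i))) \<longlonglongrightarrow> 1 - 1"
    using sums unfolding sums_def by (intro tendsto_diff tendsto_const)
  then have "(\<lambda>m. measure \<sigma> (R m)) \<longlonglongrightarrow> 0" by (simp add: Rm)
  moreover have "0 < (e / 2) powr (1 / h)" using e by simp
  ultimately have "\<forall>\<^sub>F m in sequentially. measure \<sigma> (R m) < (e / 2) powr (1 / h)"
    by (rule order_tendstoD)
  then obtain m where m: "measure \<sigma> (R m) < (e / 2) powr (1 / h)"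
    by (auto simp: eventually_sequentially)
  have Rh: "measure \<sigma> (R m) powr h \<le> e / 2"
  proof -
    have "measure \<sigma> (R m) powr h \<le> ((e / 2) powr (1 / h)) powr h"
      using m h by (intro powr_mono2) auto
    then show ?thesis using e h by (simp add: powr_powr)
  qed
  \<comment> \<open>Any time beyond all the \<open>n\<^sub>i\<close> would do.\<close>
  define N where "N = (\<Sum>i<m. n i)"
  define X where "X A N = (\<integral>\<^sup>+x. ennreal (chaos_mass \<alpha> \<sigma> A (\<lambda>n. \<omega> n x) N powr h) \<partial>M)" for A N
  have ball: "X (B i) N \<le> ennreal (K * (\<eta> powr (1 - h) * (h * measure \<sigma> (B i) + (1 - h) * (r i powr s / \<eta>))))"
    if i: "i < m" for i
  proof -
    have "n i \<le> N" unfolding N_def using i by (intro member_le_sum) auto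
    then have "X (B i) N \<le> X (B i) (n i)"
      unfolding X_def by (rule chaos_mass_powr_decreasing[OF fin \<sigma>(2) B h])
    also have "\<dots> \<le> ennreal (small_ball_const \<alpha> * real (n i) powr (- (h * (1 - h) * \<alpha>\<^sup>2 / 4)) * measure \<sigma> (B i) powr h)"
      unfolding X_def
    proof (rule chaos_mass_small_ball[OF fin \<sigma>(2) B h n(1)])
      fix t assume "t \<in> B i"
      then have "dist (c i) t \<le> r i" using Bsub[of i] by auto
      then show "dist (c i) t \<le> 1 / real (n i)" using n(2)[of i] by linarith
    qed
    also have "\<dots> \<le> ennreal (K * (measure \<sigma> (B i) powr h * (r i powr s) powr (1 - h)))"
    proof (rule ennreal_leI)
      have "real (n i) powr (- ((1 - h) * s)) = (1 / real (n i)) powr ((1 - h) * s)"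
        by (simp add: powr_divide powr_minus_divide)
      also have "\<dots> \<le> (2 * r i) powr ((1 - h) * s)"
        using h s n(3)[of i] by (intro powr_mono2) auto
      also have "\<dots> = 2 powr ((1 - h) * s) * (r i powr s) powr (1 - h)"
        using r[of i] by (simp add: powr_mult powr_powr mult.commute)
      finally have "small_ball_const \<alpha> * real (n i) powr (- ((1 - h) * s)) * measure \<sigma> (B i) powr h
          \<le> small_ball_const \<alpha> * (2 powr ((1 - h) * s) * (r i powr s) powr (1 - h)) * measure \<sigma> (B i) powr h"
        by (intro mult_right_mono mult_left_mono) (auto simp: small_ball_const_def)
      then show "small_ball_const \<alpha> * real (n i) powr (- (h * (1 - h) * \<alpha>\<^sup>2 / 4)) * measure \<sigma> (B i) powr h
          \<le> K * (measure \<sigma> (B i) powr h * (r i powr s) powr (1 - h))"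
        unfolding exponent K_def by (simp add: mult_ac)
    qed
    also have "\<dots> \<le> ennreal (K * (\<eta> powr (1 - h) * (h * measure \<sigma> (B i) + (1 - h) * (r i powr s / \<eta>))))"
      using K r[of i] by (intro ennreal_leI mult_left_mono powr_mult_powr_le_tangent h \<eta>) auto
    finally show ?thesis .
  qed
  have "X UNIV N = X ((\<Union>i<m. B i) \<union> R m) N"
    by (rule arg_cong[where f = "\<lambda>A. X A N"]) (auto simp: R_def)
  also have "\<dots> \<le> X (\<Union>i<m. B i) N + X (R m) N"
    unfolding X_def using B R by (intro chaos_mass_powr_Un_le[OF fin \<sigma>(2) _ _ _ h]) (auto simp: R_def)
  also have "\<dots> \<le> ennreal (e / 2) + ennreal (e / 2)"
  proof (rule add_mono)
    have "X (\<Union>i<m. B i) N \<le> (\<Sum>i<m. X (B i) N)"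
      unfolding X_def by (rule chaos_mass_powr_Union_le[OF fin \<sigma>(2) B Bd h])
    also have "\<dots> \<le> (\<Sum>i<m. ennreal (K * (\<eta> powr (1 - h) * (h * measure \<sigma> (B i) + (1 - h) * (r i powr s / \<eta>)))))"
      by (intro sum_mono ball) auto
    also have "\<dots> = ennreal (\<Sum>i<m. K * (\<eta> powr (1 - h) * (h * measure \<sigma> (B i) + (1 - h) * (r i powr s / \<eta>))))"
      using K h \<eta> by (intro sum_ennreal) auto
    also have "(\<Sum>i<m. K * (\<eta> powr (1 - h) * (h * measure \<sigma> (B i) + (1 - h) * (r i powr s / \<eta>))))
        = K * \<eta> powr (1 - h) * (h * (\<Sum>i<m. measure \<sigma> (B i)) + (1 - h) * ((\<Sum>i<m. r i powr s) / \<eta>))"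
      by (simp add: sum_distrib_left sum.distrib sum_divide_distrib distrib_left mult.assoc)
    also have "\<dots> \<le> K * \<eta> powr (1 - h) * (h * 1 + (1 - h) * 1)"
    proof -
      have "(\<Sum>i<m. measure \<sigma> (B i)) \<le> 1"
        using Rm[of m] measure_nonneg[of \<sigma> "R m"] by linarith
      moreover have "(\<Sum>i<m. r i powr s) \<le> (\<Sum>i. r i powr s)"
        by (rule sum_le_suminf[OF summ]) auto
      then have "(\<Sum>i<m. r i powr s) / \<eta> \<le> 1"
        using le \<eta> by simp
      ultimately show ?thesis
        using h K by (intro mult_left_mono add_mono) auto
    qed
    also have "\<dots> = K * \<eta> powr (1 - h)" by simp
    also have "\<dots> \<le> e / 2" by (rule K\<eta>)
    finally show "X (\<Union>i<m. B i) N \<le> ennreal (e / 2)"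
      by (simp add: ennreal_leI)
  next
    have "X (R m) N \<le> X (R m) 0"
      unfolding X_def by (rule chaos_mass_powr_decreasing[OF fin \<sigma>(2) R h]) simp
    also have "\<dots> = ennreal (measure \<sigma> (R m) powr h)"
      unfolding X_def using R \<sigma>(2) by (simp add: chaos_mass_0 emeasure_space_1)
    also have "\<dots> \<le> ennreal (e / 2)"
      using Rh by (rule ennreal_leI)
    finally show "X (R m) N \<le> ennreal (e / 2)" .
  qed
  also have "\<dots> = ennreal e" using e by (simp flip: ennreal_plus)
  finally show ?thesis unfolding X_def h_def by blast
qed

end

lemma weak_limit_null_measure_unique:
  assumes "weak_limit \<mu> (null_measure borel)" "weak_limit \<mu> \<nu>"
  shows "\<nu> = null_measure borel"
proof -
  interpret \<nu>: finite_measure \<nu> using assms(2) by (simp add: weak_limit_def)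
  have sets: "sets \<nu> = sets borel" using assms(2) by (simp add: weak_limit_def)
  have lim: "(\<lambda>N. \<integral>t. f t \<partial>\<mu> N) \<longlonglongrightarrow> (\<integral>t. f t \<partial>\<rho>)"
    if "weak_limit \<mu> \<rho>" "continuous_on UNIV f" "bounded (range f)" for f :: "'a \<Rightarrow> real" and \<rho>
    using that unfolding weak_limit_def by blast
  have "(\<integral>t. 1 \<partial>\<nu>) = (\<integral>t. (1::real) \<partial>null_measure borel)"
    using lim[OF assms(2), of "\<lambda>_. 1"] lim[OF assms(1), of "\<lambda>_. 1"]
    by (intro LIMSEQ_unique[of "\<lambda>N. \<integral>t. 1 \<partial>\<mu> N"]) (auto simp: bounded_iff)
  then have "measure \<nu> (space \<nu>) = 0" by (simp add: measure_def)
  then have "emeasure \<nu> (space \<nu>) = 0" by (simp add: \<nu>.emeasure_eq_measure)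
  then have "emeasure \<nu> A = 0" for A
    using emeasure_space[of \<nu> A] by simp
  then show ?thesis by (intro measure_eqI) (auto simp: sets)
qed

text \<open>
  A bounded test function is integrated to at most its bound times the total mass.
\<close>

lemma chaos_degenerate_of_mass_tendsto_0:
  assumes \<sigma>: "finite_measure \<sigma>" "sets \<sigma> = sets borel"
    and lim: "(\<lambda>N. chaos_mass \<alpha> \<sigma> UNIV w N) \<longlonglongrightarrow> 0"
  shows "weak_limit (chaos_approx \<alpha> \<sigma> w) (chaos \<alpha> \<sigma> w) \<and> chaos \<alpha> \<sigma> w = null_measure borel"
proof -
  interpret \<sigma>: finite_measure \<sigma> by fact
  note [measurable_cong] = \<sigma>(2)
  have wl: "weak_limit (chaos_approx \<alpha> \<sigma> w) (null_measure borel)"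
    unfolding weak_limit_def
  proof (intro conjI allI impI)
    show "finite_measure (null_measure borel :: torus measure)"
      by (rule finite_measureI) simp
    fix f :: "torus \<Rightarrow> real" assume f: "continuous_on UNIV f" "bounded (range f)"
    have [measurable]: "f \<in> borel_measurable borel"
      using f(1) by (rule borel_measurable_continuous_onI)
    obtain b where b: "\<And>t. \<bar>f t\<bar> \<le> b"
      using f(2) by (auto simp: bounded_iff)
    have wm [measurable]: "chaos_weight \<alpha> w N \<in> borel_measurable \<sigma>" for N
      using measurable_chaos_weight[of N "\<lambda>_. w" \<sigma> "\<lambda>t. t" \<alpha>] measurable_ident_sets[OF \<sigma>(2)] by simp
    have bound: "norm (\<integral>t. f t \<partial>chaos_approx \<alpha> \<sigma> w N) \<le> b * chaos_mass \<alpha> \<sigma> UNIV w N" for N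
    proof -
      have "(\<integral>t. f t \<partial>chaos_approx \<alpha> \<sigma> w N) = (\<integral>t. chaos_weight \<alpha> w N t * f t \<partial>\<sigma>)"
        unfolding chaos_approx_def
        by (subst integral_density) (auto simp: less_imp_le[OF chaos_weight_pos])
      also have "norm \<dots> \<le> (\<integral>t. norm (chaos_weight \<alpha> w N t * f t) \<partial>\<sigma>)"
        by (rule integral_norm_bound)
      also have "\<dots> \<le> (\<integral>t. b * (chaos_weight \<alpha> w N t * indicator UNIV t) \<partial>\<sigma>)"
      proof (rule integral_mono')
        show "integrable \<sigma> (\<lambda>t. b * (chaos_weight \<alpha> w N t * indicator UNIV t))"
          by (intro integrable_mult_right integrable_chaos_weight \<sigma>) simp
        fix t
        show "norm (chaos_weight \<alpha> w N t * f t) \<le> b * (chaos_weight \<alpha> w N t * indicator UNIV t)"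
          using b[of t] chaos_weight_pos[of \<alpha> w N t] by (simp add: abs_mult mult.commute)
        then show "0 \<le> b * (chaos_weight \<alpha> w N t * indicator UNIV t)"
          by (rule order_trans[OF norm_ge_zero])
      qed
      finally show ?thesis by (simp add: chaos_mass_def)
    qed
    have "(\<lambda>N. b * chaos_mass \<alpha> \<sigma> UNIV w N) \<longlonglongrightarrow> 0"
      using lim by (rule tendsto_mult_right_zero)
    then have "(\<lambda>N. \<integral>t. f t \<partial>chaos_approx \<alpha> \<sigma> w N) \<longlonglongrightarrow> 0"
      by (rule Lim_null_comparison[rotated]) (rule always_eventually, rule allI, rule bound)
    then show "(\<lambda>N. \<integral>t. f t \<partial>chaos_approx \<alpha> \<sigma> w N) \<longlonglongrightarrow> (\<integral>t. f t \<partial>null_measure borel)"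
      by simp
  qed simp
  then have "chaos \<alpha> \<sigma> w = null_measure borel"
    unfolding chaos_def by (rule the_equality) (rule weak_limit_null_measure_unique[OF wl])
  with wl show ?thesis by simp
qed

lemma (in random_phases) chaos_degenerate:
  assumes \<sigma>: "prob_space \<sigma>" "sets \<sigma> = sets borel" and E: "E \<in> sets borel" "emeasure \<sigma> E = 1"
    and null: "hausdorff_measure s E = 0" and s: "0 < s" "s < \<alpha>\<^sup>2 / 4"
  shows "AE x in M. weak_limit (chaos_approx \<alpha> \<sigma> (\<lambda>n. \<omega> n x)) (chaos \<alpha> \<sigma> (\<lambda>n. \<omega> n x))
                      \<and> chaos \<alpha> \<sigma> (\<lambda>n. \<omega> n x) = null_measure borel"
proof -
  have fin: "finite_measure \<sigma>" using \<sigma>(1) by (rule prob_space.finite_measure)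
  have "0 < \<alpha>\<^sup>2" using s by linarith
  then have h: "0 < 4 * s / \<alpha>\<^sup>2" "4 * s / \<alpha>\<^sup>2 < 1"
    using s by (auto simp: field_simps)
  have "AE x in M. (\<lambda>N. chaos_mass \<alpha> \<sigma> UNIV (\<lambda>n. \<omega> n x) N) \<longlonglongrightarrow> 0"
    by (rule chaos_mass_tendsto_0[OF fin \<sigma>(2) _ h])
       (simp, rule chaos_mass_powr_small[OF \<sigma> E null s])
  then show ?thesis
    by eventually_elim (rule chaos_degenerate_of_mass_tendsto_0[OF fin \<sigma>(2)])
qed

theorem theorem5p2:
  fixes M :: "'b measure" and \<omega> :: "nat \<Rightarrow> 'b \<Rightarrow> torus" and \<alpha> :: real
  assumes "prob_space M"
    and "prob_space.indep_vars M (\<lambda>_. borel) \<omega> {1..}"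
    and "\<And>n. n \<ge> 1 \<Longrightarrow> distr M borel (\<omega> n) = torus_uniform"
  shows "(\<forall>\<sigma> :: torus measure. prob_space \<sigma> \<longrightarrow> sets \<sigma> = sets borel \<longrightarrow>
            upper_hausdorff_dim \<sigma> < ereal (\<alpha>\<^sup>2 / 4) \<longrightarrow>
            (AE x in M. weak_limit (chaos_approx \<alpha> \<sigma> (\<lambda>n. \<omega> n x)) (chaos \<alpha> \<sigma> (\<lambda>n. \<omega> n x))
                      \<and> chaos \<alpha> \<sigma> (\<lambda>n. \<omega> n x) = null_measure borel))
       \<and> (\<bar>\<alpha>\<bar> > 2 \<longrightarrow>
            (\<forall>\<sigma> :: torus measure. prob_space \<sigma> \<longrightarrow> sets \<sigma> = sets borel \<longrightarrow>
               (AE x in M. weak_limit (chaos_approx \<alpha> \<sigma> (\<lambda>n. \<omega> n x)) (chaos \<alpha> \<sigma> (\<lambda>n. \<omega> n x))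
                         \<and> chaos \<alpha> \<sigma> (\<lambda>n. \<omega> n x) = null_measure borel)))"
proof -
  interpret random_phases M \<omega>
    using assms by (intro random_phases.intro random_phases_axioms.intro)
  show ?thesis
  proof (intro conjI allI impI)
    fix \<sigma> :: "torus measure"
    assume \<sigma>: "prob_space \<sigma>" "sets \<sigma> = sets borel" and dim: "upper_hausdorff_dim \<sigma> < ereal (\<alpha>\<^sup>2 / 4)"
    obtain E where E: "E \<in> sets borel" "emeasure \<sigma> E = 1" "hausdorff_dim E < ereal (\<alpha>\<^sup>2 / 4)"
      using dim unfolding upper_hausdorff_dim_def INF_less_iff by auto
    obtain s where s: "0 \<le> s" "hausdorff_measure s E = 0" "s < \<alpha>\<^sup>2 / 4"
      using E(3) unfolding hausdorff_dim_def INF_less_iff by auto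
    \<comment> \<open>A nonempty set has positive measure in dimension \<open>0\<close>, and \<open>E\<close> is not empty.\<close>
    have "s \<noteq> 0"
      using hausdorff_measure_zero_dim_null[of E] s(2) E(2) by auto
    then show "AE x in M. weak_limit (chaos_approx \<alpha> \<sigma> (\<lambda>n. \<omega> n x)) (chaos \<alpha> \<sigma> (\<lambda>n. \<omega> n x))
                      \<and> chaos \<alpha> \<sigma> (\<lambda>n. \<omega> n x) = null_measure borel"
      using s by (intro chaos_degenerate[OF \<sigma> E(1,2) s(2)]) auto
  next
    fix \<sigma> :: "torus measure"
    assume \<alpha>: "\<bar>\<alpha>\<bar> > 2" and \<sigma>: "prob_space \<sigma>" "sets \<sigma> = sets borel"
    have "2\<^sup>2 < \<bar>\<alpha>\<bar>\<^sup>2" using \<alpha> by (intro power_strict_mono) auto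
    then have "1 < \<alpha>\<^sup>2 / 4" by simp
    then obtain s where s: "1 < s" "s < \<alpha>\<^sup>2 / 4" using dense by blast
    have "emeasure \<sigma> UNIV = 1"
      using prob_space.emeasure_space_1[OF \<sigma>(1)] sets_eq_imp_space_eq[OF \<sigma>(2)] by simp
    then show "AE x in M. weak_limit (chaos_approx \<alpha> \<sigma> (\<lambda>n. \<omega> n x)) (chaos \<alpha> \<sigma> (\<lambda>n. \<omega> n x))
                         \<and> chaos \<alpha> \<sigma> (\<lambda>n. \<omega> n x) = null_measure borel"
      using s by (intro chaos_degenerate[OF \<sigma> _ _ hausdorff_measure_torus[OF s(1)]]) auto
  qed
qed

end
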